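(* Let $X$ be a real Hilbert space, let $A,B\colon X\rightrightarrows X$ be maximally $\alpha$-monotone and maximally $\beta$-monotone, respectively, with $\alpha+\beta>0$, let $C\colon X\to X$ be $\sigma$-cocoercive, and let $\gamma,\delta>0$ satisfy $$\eta^*:=\frac{4\gamma\delta(1+\gamma\alpha)(1+\delta\beta)-(\gamma+\delta)^2}{2\gamma\delta^2(\alpha+\beta)}-\frac{\gamma}{2\sigma}>0.$$ Set $\lambda:=1+\frac\delta\gamma$, let $\eta>0$, set $S:=(1-\lambda)\mathrm{Id}+\lambda J_{\gamma A}-\delta CJ_{\gamma A}$ and $T_{A,B,C}:=\mathrm{Id}-\eta J_{\gamma A}+\eta J_{\delta B}S$. Let $x_0\in X$ and $x_{n+1}:=T_{A,B,C}x_n$. Then: (i) $T_{A,B,C}$ is single-valued and has full domain. (ii) For all $x,y\in X$, writing $T=T_{A,B,C}$, $$\|Tx-Ty\|^2\le\|x-y\|^2-\Big(\frac{\eta^*}{\eta}-1\Big)\|(\mathrm{Id}-T)x-(\mathrm{Id}-T)y\|^2-\frac{\gamma}{2\eta\sigma}\|(\mathrm{Id}-T)x-(\mathrm{Id}-T)y-2\eta\sigma(CJ_{\gamma A}x-CJ_{\gamma A}y)\|^2$$ $$\qquad-\frac{\gamma\eta}{2\delta^2(\alpha+\beta)}\|(\lambda-2+2\delta\alpha)(J_{\gamma A}x-J_{\gamma A}y)+(2-\lambda+2\delta\beta)(J_{\delta B}Sx-J_{\delta B}Sy)\|^2.$$ In particular, $T_{A,B,C}$ is conically $\frac{\eta}{\eta^*}$-averaged.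 (iii) If $\operatorname{zer}(A+B+C)\neq\varnothing$ and $\eta<\eta^*$, then $\|x_n-T_{A,B,C}x_n\|=o(1/\sqrt n)$, $(x_n)$ converges weakly to some $x^*\in\operatorname{Fix}T_{A,B,C}$, $(J_{\gamma A}x_n)$ and $(J_{\delta B}Sx_n)$ converge strongly to $J_{\gamma A}x^*=J_{\delta B}Sx^*\in\operatorname{zer}(A+B+C)$, $(CJ_{\gamma A}x_n)$ converges strongly to $CJ_{\gamma A}x^*$, and $\operatorname{zer}(A+B+C)=\{J_{\gamma A}x^*\}$.
   Context: For $A\colon X\rightrightarrows X$, $J_A:=(\mathrm{Id}+A)^{-1}$, $\operatorname{zer}A:=\{x:0\in Ax\}$. $A$ is $\alpha$-monotone ($\alpha\in\mathbb R$) if $\langle x-y,u-v\rangle\ge\alpha\|x-y\|^2$ for all $(x,u),(y,v)\in\operatorname{gra}A$; maximally $\alpha$-monotone if moreover no $\alpha$-monotone operator has a graph properly containing $\operatorname{gra}A$. $C$ is $\sigma$-cocoercive ($\sigma>0$) if $\langle x-y,Cx-Cy\rangle\ge\sigma\|Cx-Cy\|^2$ for all $x,y$. $T$ is conically $\theta$-averaged ($\theta>0$) if $T=(1-\theta)\mathrm{Id}+\theta N$ with $N$ nonexpansive. $\operatorname{Fix}T=\{x:Tx=x\}$. *)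

theory Defs
  imports "HOL-Analysis.Analysis" "HOL-Library.Landau_Symbols"
begin

definition alpha_monotone :: "real \<Rightarrow> ('a::real_inner \<Rightarrow> 'a set) \<Rightarrow> bool" where
  "alpha_monotone \<alpha> A \<longleftrightarrow>
     (\<forall>x u y v. u \<in> A x \<longrightarrow> v \<in> A y \<longrightarrow> inner (x - y) (u - v) \<ge> \<alpha> * (norm (x - y))\<^sup>2)"

definition max_alpha_monotone :: "real \<Rightarrow> ('a::real_inner \<Rightarrow> 'a set) \<Rightarrow> bool" where
  "max_alpha_monotone \<alpha> A \<longleftrightarrow> alpha_monotone \<alpha> A \<and>
     (\<forall>A'. alpha_monotone \<alpha> A' \<and> (\<forall>x. A x \<subseteq> A' x) \<longrightarrow> A' = A)"

definition cocoercive :: "real \<Rightarrow> ('a::real_inner \<Rightarrow> 'a) \<Rightarrow> bool" where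
  "cocoercive \<sigma> C \<longleftrightarrow> \<sigma> > 0 \<and>
     (\<forall>x y. inner (x - y) (C x - C y) \<ge> \<sigma> * (norm (C x - C y))\<^sup>2)"

definition op_fun :: "('a \<Rightarrow> 'b) \<Rightarrow> 'a \<Rightarrow> 'b set" where
  "op_fun f x = {f x}"

definition op_scale :: "real \<Rightarrow> ('a \<Rightarrow> 'b::real_vector set) \<Rightarrow> 'a \<Rightarrow> 'b set" where
  "op_scale c A x = (\<lambda>u. c *\<^sub>R u) ` A x"

definition op_sum :: "('a \<Rightarrow> 'b::plus set) \<Rightarrow> ('a \<Rightarrow> 'b set) \<Rightarrow> 'a \<Rightarrow> 'b set" where
  "op_sum A B x = {a + b | a b. a \<in> A x \<and> b \<in> B x}"

definition op_comp :: "('b \<Rightarrow> 'c set) \<Rightarrow> ('a \<Rightarrow> 'b set) \<Rightarrow> 'a \<Rightarrow> 'c set" where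
  "op_comp F G x = \<Union> (F ` G x)"

definition resolvent :: "('a::real_vector \<Rightarrow> 'a set) \<Rightarrow> 'a \<Rightarrow> 'a set" where
  "resolvent A x = {p. x \<in> op_sum (op_fun id) A p}"

definition zer :: "('a \<Rightarrow> 'b::zero set) \<Rightarrow> 'a set" where
  "zer A = {x. 0 \<in> A x}"

definition sv :: "('a \<Rightarrow> 'b set) \<Rightarrow> 'a \<Rightarrow> 'b" where
  "sv F x = (THE y. y \<in> F x)"

definition nonexpansive :: "('a::real_normed_vector \<Rightarrow> 'a) \<Rightarrow> bool" where
  "nonexpansive N \<longleftrightarrow> (\<forall>x y. norm (N x - N y) \<le> norm (x - y))"

definition conically_averaged :: "real \<Rightarrow> ('a::real_normed_vector \<Rightarrow> 'a) \<Rightarrow> bool" where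
  "conically_averaged \<theta> T \<longleftrightarrow> \<theta> > 0 \<and>
     (\<exists>N. nonexpansive N \<and> (\<forall>x. T x = (1 - \<theta>) *\<^sub>R x + \<theta> *\<^sub>R N x))"

definition weakly_converges :: "(nat \<Rightarrow> 'a::real_inner) \<Rightarrow> 'a \<Rightarrow> bool" where
  "weakly_converges xs x \<longleftrightarrow> (\<forall>y. (\<lambda>n. inner (xs n) y) \<longlonglongrightarrow> inner x y)"

end

theory Submission
  imports Defs
begin

text \<open>
  The condition on \<open>\<eta>s\<close> forces \<open>1 + \<gamma> * \<alpha>\<close> and \<open>1 + \<delta> * \<beta>\<close> to be positive, so both resolvents
  are everywhere defined and single-valued by Minty's theorem. That theorem is obtained by
  minimising \<open>(norm (u - x))\<^sup>2 / 4 + r\<close> over the convex hull of the triples \<open>(x, u, inner x u)\<close>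
  coming from the graph: monotonicity makes this functional nonnegative, and the parallelogram law
  makes minimising sequences Cauchy. The inequality for \<open>T\<close> adds the three (co)monotonicity
  inequalities and completes the square. Weak convergence needs no weak compactness: a cluster
  point is taken in the intersection of the closed convex hulls of the tails of the sequence. The
  two squares in the inequality for \<open>T\<close>, being summable along the iteration, give the strong
  convergence of the resolvents and of \<open>C\<close>, and hence uniqueness of the zero.
\<close>

section \<open>Minty's theorem\<close>

text \<open>Applying the half-space argument twice avoids explicit convex combinations.\<close>

lemma convex_hull_monotone_graph:
  fixes G :: "('a::real_inner \<times> 'a) set"
  assumes mono: "\<And>x u y v. (x, u) \<in> G \<Longrightarrow> (y, v) \<in> G \<Longrightarrow> inner (x - y) (u - v) \<ge> 0"
    and h: "(p, q, r) \<in> convex hull ((\<lambda>(x, u). (x, u, inner x u)) ` G)"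
  shows "inner p q \<le> r"
proof -
  let ?H = "(\<lambda>(x, u). (x, u, inner x u)) ` G"
  have cv: "convex {(p, q, r). inner a p + inner b q \<le> r + k}" for a b :: 'a and k :: real
  proof -
    have eq: "{(p, q, r). inner a p + inner b q \<le> r + k} = {w. inner (a, b, -1) w \<le> k}"
      by auto
    show ?thesis unfolding eq by (rule convex_halfspace_le)
  qed
  \<comment> \<open>Monotonicity against a fixed \<open>(y, v)\<close> is affine in the triple
    \<open>(x, u, inner x u)\<close>, hence passes to the convex hull.\<close>
  have 1: "inner v p + inner y q \<le> r + inner y v" if "(y, v) \<in> G" for y v
  proof -
    have "?H \<subseteq> {(p, q, r). inner v p + inner y q \<le> r + inner y v}"
      using mono[OF _ that] by (force simp: algebra_simps inner_commute)
    then have "convex hull ?H \<subseteq> {(p, q, r). inner v p + inner y q \<le> r + inner y v}"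
      by (rule hull_minimal) (rule cv)
    with h show ?thesis by auto
  qed
  \<comment> \<open>With \<open>(p, q, r)\<close> now fixed, fact \<open>1\<close> is affine in the
    triple of \<open>(y, v)\<close>, so it extends to the hull again; inserting
    \<open>(p, q, r)\<close> itself yields \<open>2 * inner p q \<le> 2 * r\<close>.\<close>
  have "?H \<subseteq> {(y, v, t). inner q y + inner p v \<le> t + r}"
    using 1 by (force simp: algebra_simps inner_commute)
  then have "convex hull ?H \<subseteq> {(y, v, t). inner q y + inner p v \<le> t + r}"
    by (rule hull_minimal) (rule cv)
  with h show ?thesis by (auto simp: inner_commute)
qed

text \<open>Divide by \<open>t\<close> and let \<open>t\<close> tend to 0. This extracts the
  first-order optimality condition from a perturbation along a segment.\<close>

lemma nonneg_if_quadratic_nonneg: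
  fixes a b :: real
  assumes "\<And>t. 0 < t \<Longrightarrow> t \<le> 1 \<Longrightarrow> 0 \<le> t * a + t\<^sup>2 * b"
  shows "0 \<le> a"
proof (rule tendsto_lowerbound)
  show "((\<lambda>t. a + t * b) \<longlongrightarrow> a) (at_right 0)"
    by (auto intro!: tendsto_eq_intros)
  show "\<forall>\<^sub>F t in at_right 0. 0 \<le> a + t * b"
    unfolding eventually_at_right_field
  proof (intro exI[of _ 1] conjI allI impI)
    fix t :: real assume "0 < t" "t < 1"
    with assms[of t] have "0 \<le> t * (a + t * b)" by (simp add: algebra_simps power2_eq_square)
    with \<open>0 < t\<close> show "0 \<le> a + t * b" by (simp add: zero_le_mult_iff)
  qed auto
qed auto

text \<open>The parallelogram law: if the midpoint has value at least \<open>d\<close>, two points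
  whose values exceed \<open>d\<close> by at most \<open>e\<close> and \<open>e'\<close> cannot be
  far apart. It serves both minimisation arguments below.\<close>

lemma nearly_minimal_points_close:
  fixes s s' :: "'a::real_inner"
  assumes "(norm s)\<^sup>2 / 4 + r \<le> d + e" "(norm s')\<^sup>2 / 4 + r' \<le> d + e'"
    and "d \<le> (norm ((1/2) *\<^sub>R (s + s')))\<^sup>2 / 4 + (r + r') / 2"
  shows "(norm (s - s'))\<^sup>2 \<le> 8 * (e + e')"
proof -
  have "(norm ((1/2) *\<^sub>R (s + s')))\<^sup>2 = (norm (s + s'))\<^sup>2 / 4"
    by (simp add: power_mult_distrib power2_eq_square)
  moreover have "(norm (s + s'))\<^sup>2 + (norm (s - s'))\<^sup>2 = 2 * (norm s)\<^sup>2 + 2 * (norm s')\<^sup>2"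
    by (simp add: power2_norm_eq_inner algebra_simps inner_commute)
  ultimately show ?thesis using assms by argo
qed

lemma Cauchy_if_norm_square_le:
  fixes s :: "nat \<Rightarrow> 'a::real_normed_vector"
  assumes le: "\<And>m n. m \<le> n \<Longrightarrow> (norm (s m - s n))\<^sup>2 \<le> e m"
    and e0: "e \<longlonglongrightarrow> 0"
  shows "Cauchy s"
proof (rule metric_CauchyI)
  fix \<epsilon> :: real assume "0 < \<epsilon>"
  then have "\<forall>\<^sub>F m in sequentially. e m < (\<epsilon>/2)\<^sup>2"
    using e0 by (intro order_tendstoD(2)[OF e0]) auto
  then obtain M where M: "e M < (\<epsilon>/2)\<^sup>2"
    by (auto simp: eventually_sequentially)
  have near: "norm (s M - s n) < \<epsilon>/2" if "M \<le> n" for n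
    using order_le_less_trans[OF le[OF that] M] by (rule power2_less_imp_less) (use \<open>0 < \<epsilon>\<close> in simp)
  show "\<exists>M. \<forall>m\<ge>M. \<forall>n\<ge>M. dist (s m) (s n) < \<epsilon>"
  proof (intro exI[of _ M] allI impI)
    fix m n assume "M \<le> m" "M \<le> n"
    then have "dist (s M) (s m) < \<epsilon>/2" "dist (s M) (s n) < \<epsilon>/2"
      using near by (auto simp: dist_norm)
    then show "dist (s m) (s n) < \<epsilon>"
      by (metis dist_commute dist_triangle_half_l)
  qed
qed

text \<open>The point \<open>- s / 2\<close> solves the variational inequality that is dual to minimising
  \<open>(norm s)\<^sup>2 / 4 + r\<close> over \<open>K\<close>.\<close>

lemma dual_point_exists:
  fixes K :: "('a::{real_inner, complete_space} \<times> real) set"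
  assumes K: "convex K" "K \<noteq> {}"
    and nn: "\<And>s r. (s, r) \<in> K \<Longrightarrow> 0 \<le> (norm s)\<^sup>2 / 4 + r"
  shows "\<exists>y. \<forall>(s, r)\<in>K. (norm y)\<^sup>2 + inner y s \<le> r"
proof -
  define g where "g = (\<lambda>(s::'a, r::real). (norm s)\<^sup>2 / 4 + r)"
  define d where "d = Inf (g ` K)"
  have bdd: "bdd_below (g ` K)"
    using nn by (auto simp: g_def bdd_below_def intro!: exI[of _ 0])
  have d_le: "d \<le> (norm s)\<^sup>2 / 4 + r" if "(s, r) \<in> K" for s r
    unfolding d_def using cINF_lower[OF bdd that] by (simp add: g_def)
  have d0: "0 \<le> d"
    unfolding d_def using K nn by (intro cINF_greatest) (auto simp: g_def)
  have "\<exists>w\<in>K. g w < d + 1 / real (Suc n)" for n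
    using cInf_lessD[of "g ` K" "d + 1 / real (Suc n)"] K unfolding d_def by auto
  then obtain w where w: "\<And>n. w n \<in> K" "\<And>n. g (w n) < d + 1 / real (Suc n)"
    by metis
  define s where "s = fst \<circ> w"
  define r where "r = snd \<circ> w"
  have sr: "(s n, r n) \<in> K" "(norm (s n))\<^sup>2 / 4 + r n \<le> d + 1 / real (Suc n)" for n
    using w[of n] by (auto simp: s_def r_def g_def split: prod.splits)
  have comb: "((1 - t) *\<^sub>R a + t *\<^sub>R a', (1 - t) * b + t * b') \<in> K"
    if "(a, b) \<in> K" "(a', b') \<in> K" "0 \<le> t" "t \<le> 1" for a b a' b' t
    using convexD[OF K(1) that(1,2), of "1 - t" t] that by auto
  have "Cauchy s"
  proof (rule Cauchy_if_norm_square_le)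
    fix m n :: nat assume "m \<le> n"
    have "((1/2) *\<^sub>R (s m + s n), (r m + r n) / 2) \<in> K"
      using comb[OF sr(1)[of m] sr(1)[of n], of "1/2"] by (simp add: algebra_simps add_divide_distrib)
    from nearly_minimal_points_close[OF sr(2) sr(2) d_le[OF this]]
    have "(norm (s m - s n))\<^sup>2 \<le> 8 * (1 / real (Suc m) + 1 / real (Suc n))" .
    also have "\<dots> \<le> 16 * (1 / real (Suc m))"
      using \<open>m \<le> n\<close> frac_le[of 1 1 "real (Suc m)" "real (Suc n)"] by simp
    finally show "(norm (s m - s n))\<^sup>2 \<le> 16 * (1 / real (Suc m))" .
  next
    show "(\<lambda>m. 16 * (1 / real (Suc m))) \<longlonglongrightarrow> 0"
      using tendsto_mult_right_zero[OF LIMSEQ_inverse_real_of_nat, of 16]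
      by (simp add: inverse_eq_divide)
  qed
  then obtain l where l: "s \<longlonglongrightarrow> l"
    by (auto simp: Cauchy_convergent_iff convergent_def)
  have e0: "(\<lambda>n. 1 / real (Suc n)) \<longlonglongrightarrow> 0"
    using LIMSEQ_inverse_real_of_nat by (simp add: inverse_eq_divide)
  define y where "y = - (1/2) *\<^sub>R l"
  have "(norm y)\<^sup>2 + inner y s' \<le> r'" if sr': "(s', r') \<in> K" for s' r'
  proof -
    have lin: "inner l (s' - l) = inner l s' - (norm l)\<^sup>2"
      by (simp add: inner_diff_right power2_norm_eq_inner)
    \<comment> \<open>First-order condition at the limit in the direction of
      \<open>(s', r')\<close>; the number \<open>d - (norm l)\<^sup>2 / 4\<close> takes the place of
      the limit of \<open>r n\<close>.\<close>
    have "0 \<le> inner l (s' - l) / 2 + r' - (d - (norm l)\<^sup>2 / 4)"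
    proof (rule nonneg_if_quadratic_nonneg)
      fix t :: real assume t: "0 < t" "t \<le> 1"
      \<comment> \<open>Near-minimality eliminates \<open>r n\<close>, so that passing to the limit
        needs convergence of \<open>s\<close> only.\<close>
      have ineq: "d \<le> (norm ((1 - t) *\<^sub>R s n + t *\<^sub>R s'))\<^sup>2 / 4 +
          (1 - t) * (d + 1 / real (Suc n) - (norm (s n))\<^sup>2 / 4) + t * r'" for n
      proof -
        have "d \<le> (norm ((1 - t) *\<^sub>R s n + t *\<^sub>R s'))\<^sup>2 / 4 + ((1 - t) * r n + t * r')"
          using t by (intro d_le comb sr sr') auto
        moreover have "(1 - t) * r n \<le> (1 - t) * (d + 1 / real (Suc n) - (norm (s n))\<^sup>2 / 4)"
          using sr(2)[of n] t by (intro mult_left_mono) auto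
        ultimately show ?thesis by linarith
      qed
      have "(\<lambda>n. (norm ((1 - t) *\<^sub>R s n + t *\<^sub>R s'))\<^sup>2 / 4 +
          (1 - t) * (d + 1 / real (Suc n) - (norm (s n))\<^sup>2 / 4) + t * r')
        \<longlonglongrightarrow> (norm ((1 - t) *\<^sub>R l + t *\<^sub>R s'))\<^sup>2 / 4 +
          (1 - t) * (d + 0 - (norm l)\<^sup>2 / 4) + t * r'"
        by (intro tendsto_intros l e0) auto
      then have "d \<le> (norm ((1 - t) *\<^sub>R l + t *\<^sub>R s'))\<^sup>2 / 4 +
          (1 - t) * (d + 0 - (norm l)\<^sup>2 / 4) + t * r'"
        using ineq by (intro LIMSEQ_le_const) auto
      moreover have "(norm ((1 - t) *\<^sub>R l + t *\<^sub>R s'))\<^sup>2 =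
          (norm l)\<^sup>2 + 2 * t * (inner l s' - (norm l)\<^sup>2) + t\<^sup>2 * (norm (s' - l))\<^sup>2"
        unfolding power2_norm_eq_inner
        by (simp add: algebra_simps inner_commute power2_eq_square)
      ultimately show "0 \<le> t * (inner l (s' - l) / 2 + r' - (d - (norm l)\<^sup>2 / 4))
          + t\<^sup>2 * ((norm (s' - l))\<^sup>2 / 4)"
        unfolding lin by (simp add: field_simps)
    qed
    moreover have "(norm y)\<^sup>2 = (norm l)\<^sup>2 / 4"
      by (simp add: y_def power_mult_distrib power2_eq_square)
    moreover have "inner y s' = - inner l s' / 2" by (simp add: y_def)
    \<comment> \<open>The condition reads \<open>(norm y)\<^sup>2 + inner y s' + d \<le> r'\<close>,
      and \<open>d \<ge> 0\<close> may be dropped.\<close>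
    ultimately show ?thesis using d0 lin by linarith
  qed
  then show ?thesis by auto
qed

text \<open>Every target \<open>w\<close> splits as \<open>y + (w - y)\<close> with the pair
  \<open>(y, w - y)\<close> monotonically related to the graph. After expansion this is exactly the
  variational inequality of the dual point, tested on the graph points.\<close>

theorem Minty_monotone_extension:
  fixes G :: "('a::{real_inner, complete_space} \<times> 'a) set"
  assumes mono: "\<And>x u y v. (x, u) \<in> G \<Longrightarrow> (y, v) \<in> G \<Longrightarrow> inner (x - y) (u - v) \<ge> 0"
  shows "\<exists>y. \<forall>(x, u)\<in>G. inner (x - y) (u - (w - y)) \<ge> 0"
proof (cases "G = {}")
  case False
  \<comment> \<open>Shifting the values by \<open>w\<close> reduces the claim to the target 0, that
    is, to a pair \<open>(y, - y)\<close>.\<close>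
  define G' where "G' = (\<lambda>(x, u). (x, u - w)) ` G"
  define H where "H = convex hull ((\<lambda>(x, u). (x, u, inner x u)) ` G')"
  define f where "f = (\<lambda>(p::'a, q::'a, r::real). (q - p, r))"
  have mono': "(x, u) \<in> G' \<Longrightarrow> (y, v) \<in> G' \<Longrightarrow> inner (x - y) (u - v) \<ge> 0" for x u y v
    using mono by (force simp: G'_def)
  have lin: "linear f"
    by (rule linearI) (auto simp: f_def algebra_simps)
  have "\<exists>y. \<forall>(s, r)\<in>f ` H. (norm y)\<^sup>2 + inner y s \<le> r"
  proof (rule dual_point_exists)
    show "convex (f ` H)"
      unfolding H_def by (rule convex_linear_image[OF lin convex_convex_hull])
    show "f ` H \<noteq> {}"
      using False by (auto simp: H_def G'_def)
    show "0 \<le> (norm s)\<^sup>2 / 4 + r" if sr: "(s, r) \<in> f ` H" for s r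
    proof -
      obtain p q where pq: "s = q - p" "(p, q, r) \<in> H"
        using sr by (auto simp: f_def)
      have "inner p q \<le> r"
        using mono' pq(2) unfolding H_def by (rule convex_hull_monotone_graph)
      \<comment> \<open>Together with \<open>inner p q \<le> r\<close> this bounds the functional
        below by \<open>(norm (p + q))\<^sup>2 / 4\<close>.\<close>
      moreover have "(norm s)\<^sup>2 + 4 * inner p q = (norm (p + q))\<^sup>2"
        unfolding pq(1) power2_norm_eq_inner by (simp add: inner_simps inner_commute)
      moreover have "0 \<le> (norm (p + q))\<^sup>2" by simp
      ultimately show ?thesis by linarith
    qed
  qed
  then obtain y where y: "\<And>s r. (s, r) \<in> f ` H \<Longrightarrow> (norm y)\<^sup>2 + inner y s \<le> r"
    by blast
  have "inner (x - y) (u - (w - y)) \<ge> 0" if "(x, u) \<in> G" for x u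
  proof -
    have "(x, u - w, inner x (u - w)) \<in> H"
      unfolding H_def G'_def using that by (intro hull_inc) (auto simp: image_image intro!: image_eqI)
    then have "f (x, u - w, inner x (u - w)) \<in> f ` H"
      by (rule imageI)
    then have "(norm y)\<^sup>2 + inner y (u - w - x) \<le> inner x (u - w)"
      by (intro y) (simp add: f_def)
    then show ?thesis
      unfolding power2_norm_eq_inner by (simp add: inner_simps inner_commute)
  qed
  then show ?thesis by blast
qed auto

section \<open>Resolvents\<close>

lemma mem_resolvent_iff:
  "p \<in> resolvent (op_scale \<gamma> A) x \<longleftrightarrow> (\<exists>u\<in>A p. x = p + \<gamma> *\<^sub>R u)"
  by (auto simp: resolvent_def op_sum_def op_fun_def op_scale_def)

text \<open>Adjoining the single pair \<open>(y, v)\<close> to the graph keeps it \<alpha>-monotone,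
  so by maximality the pair was already there.\<close>

lemma max_alpha_monotone_mem:
  assumes mA: "max_alpha_monotone \<alpha> A"
    and rel: "\<And>x u. u \<in> A x \<Longrightarrow> inner (x - y) (u - v) \<ge> \<alpha> * (norm (x - y))\<^sup>2"
  shows "v \<in> A y"
proof -
  define A' where "A' = (\<lambda>x. if x = y then insert v (A x) else A x)"
  have A: "inner (x - x') (u - u') \<ge> \<alpha> * (norm (x - x'))\<^sup>2" if "u \<in> A x" "u' \<in> A x'" for x x' u u'
    using mA that by (auto simp: max_alpha_monotone_def alpha_monotone_def)
  have rel': "inner (y - x) (v - u) \<ge> \<alpha> * (norm (y - x))\<^sup>2" if "u \<in> A x" for x u
    using rel[OF that] by (simp add: norm_minus_commute algebra_simps)
  have "alpha_monotone \<alpha> A'"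
    unfolding alpha_monotone_def A'_def using A rel rel' by (auto split: if_splits)
  moreover have "\<forall>x. A x \<subseteq> A' x" by (auto simp: A'_def)
  ultimately have "A' = A"
    using mA by (auto simp: max_alpha_monotone_def)
  moreover have "v \<in> A' y" by (simp add: A'_def)
  ultimately show ?thesis by simp
qed

lemma resolvent_mono:
  assumes "alpha_monotone \<alpha> A" "\<gamma> > 0"
    "p \<in> resolvent (op_scale \<gamma> A) x" "q \<in> resolvent (op_scale \<gamma> A) y"
  shows "inner (p - q) (x - y - (p - q)) \<ge> \<gamma> * \<alpha> * (norm (p - q))\<^sup>2"
proof -
  obtain u v where uv: "u \<in> A p" "v \<in> A q" "x = p + \<gamma> *\<^sub>R u" "y = q + \<gamma> *\<^sub>R v"
    using assms(3,4) by (auto simp: mem_resolvent_iff)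
  have "\<alpha> * (norm (p - q))\<^sup>2 \<le> inner (p - q) (u - v)"
    using assms(1) uv by (auto simp: alpha_monotone_def)
  then have "\<gamma> * (\<alpha> * (norm (p - q))\<^sup>2) \<le> \<gamma> * inner (p - q) (u - v)"
    using \<open>\<gamma> > 0\<close> by (intro mult_left_mono) auto
  moreover have "x - y - (p - q) = \<gamma> *\<^sub>R (u - v)"
    by (simp add: uv algebra_simps)
  ultimately show ?thesis by simp
qed

text \<open>Existence: with \<open>c = 1 + \<gamma> * \<alpha>\<close>, the operator
  \<open>(\<gamma> / c) (A - \<alpha> Id)\<close> is monotone, and its resolvent at
  \<open>x / c\<close> solves the same inclusion as that of \<open>\<gamma> A\<close> at
  \<open>x\<close>. Minty's theorem supplies the point and maximality of \<open>A\<close> puts it in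
  the graph. Uniqueness: \<open>c > 0\<close> makes the resolvent inequality strict for distinct
  points.\<close>

lemma resolvent_singleton:
  fixes A :: "'a::{real_inner, complete_space} \<Rightarrow> 'a set"
  assumes mA: "max_alpha_monotone \<alpha> A" and g: "\<gamma> > 0" and c: "1 + \<gamma> * \<alpha> > 0"
  shows "\<exists>p. resolvent (op_scale \<gamma> A) x = {p}"
proof -
  have am: "alpha_monotone \<alpha> A" using mA by (simp add: max_alpha_monotone_def)
  define c where "c = 1 + \<gamma> * \<alpha>"
  have c0: "c > 0" using c by (simp add: c_def)
  define G where "G = {(y, (\<gamma> / c) *\<^sub>R (u - \<alpha> *\<^sub>R y)) | y u. u \<in> A y}"
  have "\<exists>y. \<forall>(z, u)\<in>G. inner (z - y) (u - ((1 / c) *\<^sub>R x - y)) \<ge> 0"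
  proof (rule Minty_monotone_extension)
    fix y v z w assume "(y, v) \<in> G" "(z, w) \<in> G"
    then obtain u u' where u: "u \<in> A y" "u' \<in> A z"
      "v = (\<gamma> / c) *\<^sub>R (u - \<alpha> *\<^sub>R y)" "w = (\<gamma> / c) *\<^sub>R (u' - \<alpha> *\<^sub>R z)"
      by (auto simp: G_def)
    have "\<alpha> * (norm (y - z))\<^sup>2 \<le> inner (y - z) (u - u')"
      using am u by (auto simp: alpha_monotone_def)
    then have "0 \<le> (\<gamma> / c) * (inner (y - z) (u - u') - \<alpha> * (norm (y - z))\<^sup>2)"
      using g c0 by (intro mult_nonneg_nonneg) auto
    also have "\<dots> = inner (y - z) ((\<gamma> / c) *\<^sub>R (u - u' - \<alpha> *\<^sub>R (y - z)))"
      by (simp add: power2_norm_eq_inner inner_diff_right[of "y - z" _ "\<alpha> *\<^sub>R (y - z)"])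
    also have "(\<gamma> / c) *\<^sub>R (u - u' - \<alpha> *\<^sub>R (y - z)) = v - w"
      by (simp add: u algebra_simps)
    finally show "inner (y - z) (v - w) \<ge> 0" .
  qed
  then obtain y where y: "\<And>z u. u \<in> A z \<Longrightarrow>
      inner (z - y) ((\<gamma> / c) *\<^sub>R (u - \<alpha> *\<^sub>R z) - ((1 / c) *\<^sub>R x - y)) \<ge> 0"
    by (auto simp: G_def)
  have "(1 / \<gamma>) *\<^sub>R (x - y) \<in> A y"
  proof (rule max_alpha_monotone_mem[OF mA])
    fix z u assume "u \<in> A z"
    \<comment> \<open>The identity \<open>(\<gamma> / c) * (1 / \<gamma> + \<alpha>) = 1\<close>
      turns the pair found for the rescaled operator into the candidate
      \<open>(y, (x - y) / \<gamma>)\<close> for \<open>A\<close>.\<close>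
    have "(\<gamma> / c) *\<^sub>R (u - \<alpha> *\<^sub>R z) - ((1 / c) *\<^sub>R x - y) =
        (\<gamma> / c) *\<^sub>R ((u - (1 / \<gamma>) *\<^sub>R (x - y)) - \<alpha> *\<^sub>R (z - y))"
    proof -
      have "(\<gamma> / c) * (1 / \<gamma> + \<alpha>) = 1"
      proof -
        have "\<gamma> * (1 / \<gamma> + \<alpha>) = c" using g by (simp add: c_def distrib_left)
        then show ?thesis using c0 by simp
      qed
      then have "y = (\<gamma> / c) *\<^sub>R ((1 / \<gamma>) *\<^sub>R y + \<alpha> *\<^sub>R y)"
        by (metis scaleR_left.add scaleR_one scaleR_scaleR)
      moreover have "(1 / c) *\<^sub>R x = (\<gamma> / c) *\<^sub>R ((1 / \<gamma>) *\<^sub>R x)"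
        using g by simp
      ultimately have "(\<gamma> / c) *\<^sub>R (u - \<alpha> *\<^sub>R z) - ((1 / c) *\<^sub>R x - y) =
        (\<gamma> / c) *\<^sub>R (u - \<alpha> *\<^sub>R z) - ((\<gamma> / c) *\<^sub>R ((1 / \<gamma>) *\<^sub>R x) - (\<gamma> / c) *\<^sub>R ((1 / \<gamma>) *\<^sub>R y + \<alpha> *\<^sub>R y))"
        by argo
      then show ?thesis by (simp add: scaleR_diff_right scaleR_add_right)
    qed
    with y[OF \<open>u \<in> A z\<close>]
    have "0 \<le> (\<gamma> / c) * inner (z - y) ((u - (1 / \<gamma>) *\<^sub>R (x - y)) - \<alpha> *\<^sub>R (z - y))"
      by simp
    then have "0 \<le> inner (z - y) ((u - (1 / \<gamma>) *\<^sub>R (x - y)) - \<alpha> *\<^sub>R (z - y))"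
      using g c0 by (simp add: zero_le_mult_iff zero_le_divide_iff)
    then show "\<alpha> * (norm (z - y))\<^sup>2 \<le> inner (z - y) (u - (1 / \<gamma>) *\<^sub>R (x - y))"
      by (simp add: inner_diff_right[of "z - y" _ "\<alpha> *\<^sub>R (z - y)"] power2_norm_eq_inner)
  qed
  then have yJ: "y \<in> resolvent (op_scale \<gamma> A) x"
    unfolding mem_resolvent_iff using g by (intro bexI[of _ "(1 / \<gamma>) *\<^sub>R (x - y)"]) auto
  moreover have "p = y" if "p \<in> resolvent (op_scale \<gamma> A) x" for p
  proof -
    from resolvent_mono[OF am g that yJ]
    have "(1 + \<gamma> * \<alpha>) * (norm (p - y))\<^sup>2 \<le> 0"
      by (simp add: power2_norm_eq_inner algebra_simps)
    with c show ?thesis by (simp add: mult_le_0_iff)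
  qed
  ultimately show ?thesis by blast
qed

section \<open>Weak convergence of averaged iterations\<close>

text \<open>This stands in for weak compactness. The minimal squared norms over the sets increase to
  a finite limit, so points of nearly minimal norm form a Cauchy sequence, whose limit lies in every
  set.\<close>

lemma nested_convex_Inter_nonempty:
  fixes K :: "nat \<Rightarrow> 'a::{real_inner, complete_space} set"
  assumes cl: "\<And>m. closed (K m)" and cv: "\<And>m. convex (K m)" and ne: "\<And>m. K m \<noteq> {}"
    and dec: "decseq K" and bd: "bounded (K 0)"
  shows "\<exists>z. \<forall>m. z \<in> K m"
proof -
  have sub: "K n \<subseteq> K m" if "m \<le> n" for m n
    using decseqD[OF dec that] .
  define d where "d m = Inf ((\<lambda>z. (norm z)\<^sup>2 / 4) ` K m)" for m
  have bdd: "bdd_below ((\<lambda>z. (norm z)\<^sup>2 / 4) ` K m)" for m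
    by (auto simp: bdd_below_def intro!: exI[of _ 0])
  have d_le: "d m \<le> (norm z)\<^sup>2 / 4" if "z \<in> K m" for m z
    unfolding d_def by (rule cINF_lower[OF bdd that])
  have mono: "incseq d"
    unfolding d_def by (intro incseq_SucI cINF_superset_mono bdd ne sub) auto
  obtain R where R: "\<And>z. z \<in> K 0 \<Longrightarrow> norm z \<le> R"
    using bd by (auto simp: bounded_iff)
  have "d m \<le> R\<^sup>2 / 4" for m
  proof -
    obtain z where z: "z \<in> K m" using ne[of m] by blast
    have "norm z \<le> R" using R sub[of 0 m] z by auto
    then have "(norm z)\<^sup>2 \<le> R\<^sup>2" by (intro power_mono) auto
    with d_le[OF z] show ?thesis by linarith
  qed
  then obtain D where D: "d \<longlonglongrightarrow> D" "\<And>m. d m \<le> D"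
    using incseq_convergent[OF mono, of "R\<^sup>2 / 4"] by blast
  have "\<exists>z\<in>K m. (norm z)\<^sup>2 / 4 < d m + 1 / real (Suc m)" for m
    using cInf_lessD[of "(\<lambda>z. (norm z)\<^sup>2 / 4) ` K m" "d m + 1 / real (Suc m)"] ne
    unfolding d_def by auto
  then obtain z where z: "\<And>m. z m \<in> K m" "\<And>m. (norm (z m))\<^sup>2 / 4 < d m + 1 / real (Suc m)"
    by metis
  have "Cauchy z"
  proof (rule Cauchy_if_norm_square_le)
    fix m n :: nat assume mn: "m \<le> n"
    have inv: "1 / real (Suc n) \<le> 1 / real (Suc m)"
      using mn by (intro frac_le) auto
    have "(1/2) *\<^sub>R (z m + z n) \<in> K m"
      using convexD[OF cv z(1), of "z n" m "1/2" "1/2"] z(1)[of n] sub[OF mn]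
      by (auto simp: scaleR_add_right)
    then have mid: "d m \<le> (norm ((1/2) *\<^sub>R (z m + z n)))\<^sup>2 / 4 + (0 + 0) / 2"
      using d_le by (metis add_0 add_0_right div_0)
    \<comment> \<open>Both points are compared with the level \<open>d m\<close> of the larger set
      \<open>K m\<close>; since \<open>d n \<le> D\<close>, the excess of \<open>z n\<close> costs
      an extra \<open>D - d m\<close>.\<close>
    have "(norm (z m - z n))\<^sup>2 \<le> 8 * (1 / real (Suc m) + (D - d m + 1 / real (Suc m)))"
    proof (rule nearly_minimal_points_close[OF _ _ mid])
      show "(norm (z m))\<^sup>2 / 4 + 0 \<le> d m + 1 / real (Suc m)"
        using z(2)[of m] by simp
      show "(norm (z n))\<^sup>2 / 4 + 0 \<le> d m + (D - d m + 1 / real (Suc m))"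
        using z(2)[of n] D(2)[of n] inv by linarith
    qed
    then show "(norm (z m - z n))\<^sup>2 \<le> 8 * (2 * (1 / real (Suc m)) + (D - d m))"
      by simp
  next
    have e0: "(\<lambda>n. 1 / real (Suc n)) \<longlonglongrightarrow> 0"
      using LIMSEQ_inverse_real_of_nat by (simp add: inverse_eq_divide)
    have "(\<lambda>m. 8 * (2 * (1 / real (Suc m)) + (D - d m))) \<longlonglongrightarrow> 8 * (2 * 0 + (D - D))"
      by (intro tendsto_intros e0 D)
    then show "(\<lambda>m. 8 * (2 * (1 / real (Suc m)) + (D - d m))) \<longlonglongrightarrow> 0" by simp
  qed
  then obtain l where l: "z \<longlonglongrightarrow> l"
    by (auto simp: Cauchy_convergent_iff convergent_def)
  have "l \<in> K m" for m
  proof (rule Lim_in_closed_set[OF cl _ _ l])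
    show "\<forall>\<^sub>F n in sequentially. z n \<in> K m"
      using z(1) sub by (intro eventually_sequentiallyI[of m]) blast
  qed auto
  then show ?thesis by blast
qed

text \<open>A substitute for the set of weak cluster points: closed convex sets are weakly closed,
  so all weak subsequential limits lie in it.\<close>

definition tail_hulls :: "(nat \<Rightarrow> 'a::real_normed_vector) \<Rightarrow> 'a set" where
  "tail_hulls x = (\<Inter>m. closure (convex hull (x ` {m..})))"

lemma tail_hulls_nonempty:
  fixes x :: "nat \<Rightarrow> 'a::{real_inner, complete_space}"
  assumes "bounded (range x)"
  shows "tail_hulls x \<noteq> {}"
proof -
  have "\<exists>z. \<forall>m. z \<in> closure (convex hull (x ` {m..}))"
  proof (rule nested_convex_Inter_nonempty)
    show "decseq (\<lambda>m. closure (convex hull (x ` {m..})))"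
      by (intro decseq_SucI closure_mono hull_mono image_mono) auto
    show "bounded (closure (convex hull (x ` {0..})))"
      using bounded_subset[OF assms] by (intro bounded_closure bounded_convex_hull) auto
  qed (auto intro!: convex_closure convex_convex_hull)
  then show ?thesis by (auto simp: tail_hulls_def)
qed

lemma tail_hulls_subseq:
  assumes "strict_mono r"
  shows "tail_hulls (x \<circ> r) \<subseteq> tail_hulls x"
proof -
  have "(x \<circ> r) ` {m..} \<subseteq> x ` {m..}" for m
    using seq_suble[OF assms] order_trans by fastforce
  then show ?thesis
    unfolding tail_hulls_def by (intro INF_superset_mono closure_mono hull_mono) auto
qed

text \<open>A half-space is closed and convex, so one that contains a tail contains the closed hull
  of that tail.\<close>

lemma tail_hulls_inner_le:
  assumes "z \<in> tail_hulls x" "\<forall>\<^sub>F n in sequentially. inner (x n) w \<le> b"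
  shows "inner z w \<le> b"
proof -
  obtain m where m: "\<And>n. m \<le> n \<Longrightarrow> inner (x n) w \<le> b"
    using assms(2) by (auto simp: eventually_sequentially)
  have "closure (convex hull (x ` {m..})) \<subseteq> {z. inner w z \<le> b}"
    using m by (intro closure_minimal hull_minimal closed_halfspace_le convex_halfspace_le)
      (auto simp: inner_commute)
  with assms(1) show ?thesis by (auto simp: tail_hulls_def inner_commute)
qed

lemma tail_hulls_inner_limit:
  assumes z: "z \<in> tail_hulls x" and lim: "(\<lambda>n. inner (x n) w) \<longlonglongrightarrow> L"
  shows "inner z w = L"
proof (rule antisym)
  show "inner z w \<le> L"
  proof (rule field_le_epsilon)
    fix e :: real assume "0 < e"
    then have "\<forall>\<^sub>F n in sequentially. inner (x n) w < L + e"
      by (intro order_tendstoD(2)[OF lim]) auto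
    then show "inner z w \<le> L + e"
      by (intro tail_hulls_inner_le[OF z]) (auto elim: eventually_mono)
  qed
  show "L \<le> inner z w"
  proof (rule field_le_epsilon)
    fix e :: real assume "0 < e"
    then have "\<forall>\<^sub>F n in sequentially. L - e < inner (x n) w"
      by (intro order_tendstoD(1)[OF lim]) auto
    then have "inner z (- w) \<le> - (L - e)"
      by (intro tail_hulls_inner_le[OF z]) (auto elim: eventually_mono)
    then show "L \<le> inner z w + e" by simp
  qed
qed

text \<open>The difference of squared distances to two points is affine in the iterate, so two
  points of the tail hulls have the same inner product with their difference.\<close>

lemma weak_limit_of_Fejer:
  fixes x :: "nat \<Rightarrow> 'a::{real_inner, complete_space}"
  assumes bd: "bounded (range x)"
    and conv: "\<And>z. z \<in> tail_hulls x \<Longrightarrow> convergent (\<lambda>n. (norm (x n - z))\<^sup>2)"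
  shows "\<exists>z\<in>tail_hulls x. weakly_converges x z"
proof -
  have single: "z = z'" if z: "z \<in> tail_hulls x" "z' \<in> tail_hulls x" for z z'
  proof -
    obtain L L' where L: "(\<lambda>n. (norm (x n - z))\<^sup>2) \<longlonglongrightarrow> L" "(\<lambda>n. (norm (x n - z'))\<^sup>2) \<longlonglongrightarrow> L'"
      using conv z by (meson convergent_def)
    have "inner (x n) (z - z') =
        ((norm (x n - z'))\<^sup>2 - (norm (x n - z))\<^sup>2 + (norm z)\<^sup>2 - (norm z')\<^sup>2) / 2" for n
      unfolding power2_norm_eq_inner by (simp add: inner_simps inner_commute)
    moreover have "(\<lambda>n. ((norm (x n - z'))\<^sup>2 - (norm (x n - z))\<^sup>2 + (norm z)\<^sup>2 - (norm z')\<^sup>2) / 2)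
        \<longlonglongrightarrow> (L' - L + (norm z)\<^sup>2 - (norm z')\<^sup>2) / 2"
      by (intro tendsto_intros L) auto
    ultimately have "(\<lambda>n. inner (x n) (z - z')) \<longlonglongrightarrow> (L' - L + (norm z)\<^sup>2 - (norm z')\<^sup>2) / 2"
      by presburger
    from tail_hulls_inner_limit[OF z(1) this] tail_hulls_inner_limit[OF z(2) this]
    have "inner (z - z') (z - z') = 0" by (simp add: inner_diff_left)
    then show ?thesis by simp
  qed
  obtain z where z: "z \<in> tail_hulls x"
    using tail_hulls_nonempty[OF bd] by blast
  \<comment> \<open>Otherwise a subsequence stays in the half-space
    \<open>inner z w + e \<le> inner _ w\<close>. Its tail hulls have a common point in the same
    half-space, which by \<open>single\<close> must be \<open>z\<close>.\<close>
  have upper: "\<forall>\<^sub>F n in sequentially. inner (x n) w < inner z w + e" if e: "0 < e" for w e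
  proof (rule ccontr)
    assume "\<not> ?thesis"
    then have "infinite {n. inner z w + e \<le> inner (x n) w}"
      by (simp add: not_eventually not_less flip: frequently_cofinite cofinite_eq_sequentially)
    then obtain r :: "nat \<Rightarrow> nat" where r: "strict_mono r" "\<And>n. inner z w + e \<le> inner (x (r n)) w"
      using infinite_enumerate[of "{n. inner z w + e \<le> inner (x n) w}"] by auto
    have "bounded (range (x \<circ> r))"
      by (rule bounded_subset[OF bd]) auto
    then obtain z' where z': "z' \<in> tail_hulls (x \<circ> r)"
      using tail_hulls_nonempty by blast
    then have "z' = z" using single z tail_hulls_subseq[OF r(1), of x] by blast
    moreover have "inner z' (- w) \<le> - (inner z w + e)"
    proof (rule tail_hulls_inner_le[OF z'])
      have "inner ((x \<circ> r) n) (- w) \<le> - (inner z w + e)" for n using r(2)[of n] by simp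
      then show "\<forall>\<^sub>F n in sequentially. inner ((x \<circ> r) n) (- w) \<le> - (inner z w + e)"
        by (rule always_eventually[OF allI])
    qed
    ultimately show False using e by simp
  qed
  have "weakly_converges x z"
    unfolding weakly_converges_def
  proof (intro allI order_tendstoI)
    fix w a
    show "\<forall>\<^sub>F n in sequentially. inner (x n) w < a" if "inner z w < a"
      using upper[of "a - inner z w" w] that by simp
    show "\<forall>\<^sub>F n in sequentially. a < inner (x n) w" if "a < inner z w"
      using upper[of "inner z w - a" "- w"] that by simp
  qed
  with z show ?thesis by blast
qed

section \<open>Fixed points of nonexpansive maps and averaged iterations\<close>

lemma nonexpansive_imp_monotone_displacement:
  assumes "nonexpansive T"
  shows "0 \<le> inner (x - y) ((x - T x) - (y - T y))"
proof -
  have "inner (x - y) (T x - T y) \<le> norm (x - y) * norm (T x - T y)"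
    by (rule norm_cauchy_schwarz)
  also have "\<dots> \<le> norm (x - y) * norm (x - y)"
    using assms by (intro mult_left_mono) (auto simp: nonexpansive_def)
  also have "\<dots> = inner (x - y) (x - y)"
    by (simp add: dot_square_norm power2_eq_square)
  finally show ?thesis by (simp add: inner_simps)
qed

lemma nonexpansive_tendsto:
  assumes "nonexpansive T" "(f \<longlongrightarrow> l) F"
  shows "((\<lambda>t. T (f t)) \<longlongrightarrow> T l) F"
proof -
  have "((\<lambda>t. norm (f t - l)) \<longlongrightarrow> 0) F"
    using assms(2) by (simp add: tendsto_norm_zero_iff LIM_zero_iff)
  then have "((\<lambda>t. T (f t) - T l) \<longlongrightarrow> 0) F"
  proof (rule Lim_null_comparison[rotated])
    show "\<forall>\<^sub>F t in F. norm (T (f t) - T l) \<le> norm (f t - l)"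
      using assms(1) by (simp add: nonexpansive_def)
  qed
  then show ?thesis by (simp add: LIM_zero_iff)
qed

text \<open>A demiclosedness principle, by Minty's trick of testing monotonicity of \<open>Id - T\<close> along
  rays from \<open>z\<close>.\<close>

lemma tail_hulls_subset_Fix:
  fixes x :: "nat \<Rightarrow> 'a::real_inner"
  assumes T: "nonexpansive T" and bd: "bounded (range x)"
    and asym: "(\<lambda>n. x n - T (x n)) \<longlonglongrightarrow> 0" and z: "z \<in> tail_hulls x"
  shows "T z = z"
proof -
  obtain R where R: "\<And>n. norm (x n) \<le> R"
    using bd by (auto simp: bounded_iff)
  \<comment> \<open>Monotonicity of \<open>Id - T\<close> between \<open>x n\<close> and
    \<open>y\<close> bounds \<open>inner (x n - y) (y - T y)\<close> by a bounded factor times the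
    vanishing residual; the bound then passes to the tail hulls.\<close>
  have mono: "inner (z - y) (y - T y) \<le> 0" for y
  proof -
    have "inner z (y - T y) \<le> inner y (y - T y) + e" if "0 < e" for e
    proof (rule tail_hulls_inner_le[OF z])
      have "(\<lambda>n. norm (x n - T (x n)) * (R + norm y)) \<longlonglongrightarrow> 0"
        using asym by (intro tendsto_mult_left_zero tendsto_norm_zero)
      then have "\<forall>\<^sub>F n in sequentially. norm (x n - T (x n)) * (R + norm y) < e"
        using that by (rule order_tendstoD)
      then show "\<forall>\<^sub>F n in sequentially. inner (x n) (y - T y) \<le> inner y (y - T y) + e"
      proof (rule eventually_mono)
        fix n assume n: "norm (x n - T (x n)) * (R + norm y) < e"
        have "inner (x n - y) (y - T y) \<le> inner (x n - y) (x n - T (x n))"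
          using nonexpansive_imp_monotone_displacement[OF T, of "x n" y]
          by (simp add: inner_diff_right)
        also have "\<dots> \<le> norm (x n - y) * norm (x n - T (x n))"
          by (rule norm_cauchy_schwarz)
        also have "\<dots> \<le> (R + norm y) * norm (x n - T (x n))"
          using norm_triangle_ineq4[of "x n" y] R[of n] by (intro mult_right_mono) auto
        finally show "inner (x n) (y - T y) \<le> inner y (y - T y) + e"
          using n by (simp add: inner_diff_left mult.commute)
      qed
    qed
    then have "inner z (y - T y) \<le> inner y (y - T y)" by (rule field_le_epsilon)
    then show ?thesis by (simp add: inner_diff_left)
  qed
  define v where "v = z - T z"
  \<comment> \<open>Since \<open>z - y t = t *\<^sub>R v\<close>, \<open>mono\<close> gives
    \<open>inner v (y t - T (y t)) \<le> 0\<close>; letting \<open>t\<close> tend to 0 leaves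
    \<open>inner v v \<le> 0\<close>.\<close>
  define y where "y t = z - t *\<^sub>R v" for t :: real
  have y_lim: "(y \<longlongrightarrow> z) (at_right 0)"
    unfolding y_def by (auto intro!: tendsto_eq_intros)
  have "((\<lambda>t. inner v (y t - T (y t))) \<longlongrightarrow> inner v (z - T z)) (at_right 0)"
    by (intro tendsto_intros nonexpansive_tendsto[OF T] y_lim)
  moreover have "\<forall>\<^sub>F t in at_right 0. inner v (y t - T (y t)) \<le> 0"
    using eventually_at_right_less
  proof (rule eventually_mono)
    fix t :: real assume t: "0 < t"
    have "t * inner v (y t - T (y t)) = inner (z - y t) (y t - T (y t))"
      by (simp add: y_def)
    also have "\<dots> \<le> 0" by (rule mono)
    finally show "inner v (y t - T (y t)) \<le> 0"
      using t by (simp add: mult_le_0_iff)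
  qed
  ultimately have "inner v (z - T z) \<le> 0"
    by (intro tendsto_upperbound[of "\<lambda>t. inner v (y t - T (y t))" _ "at_right 0"]) auto
  then have "inner v v = 0"
    by (metis v_def inner_ge_zero order_antisym)
  then show ?thesis by (simp add: v_def)
qed

text \<open>The terms between \<open>n div 2\<close> and \<open>n\<close> are all at least
  \<open>a n\<close>, and their sum is small by the Cauchy criterion.\<close>

lemma summable_decseq_times_n_tendsto_0:
  fixes a :: "nat \<Rightarrow> real"
  assumes "summable a" "decseq a" "\<And>n. 0 \<le> a n"
  shows "(\<lambda>n. real n * a n) \<longlonglongrightarrow> 0"
proof (rule LIMSEQ_I)
  fix e :: real assume "0 < e"
  then obtain N where N: "\<And>m n. N \<le> m \<Longrightarrow> norm (sum a {m..<n}) < e / 2"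
    using assms(1) unfolding summable_Cauchy by (meson half_gt_zero)
  have "norm (real n * a n - 0) < e" if n: "2 * N \<le> n" for n
  proof -
    define m where "m = n div 2"
    have "real (n - m) * a n = (\<Sum>k\<in>{m..<n}. a n)" by simp
    also have "\<dots> \<le> sum a {m..<n}"
      using decseqD[OF assms(2)] by (intro sum_mono) auto
    also have "\<dots> < e / 2"
    proof -
      have "N \<le> m" using n by (simp add: m_def)
      from N[OF this, of n] show ?thesis by simp
    qed
    finally have "real (n - m) * a n < e / 2" .
    moreover have "real n / 2 * a n \<le> real (n - m) * a n"
      using assms(3) unfolding m_def by (intro mult_right_mono) linarith+
    ultimately show ?thesis using assms(3)[of n] by simp
  qed
  then show "\<exists>N. \<forall>n\<ge>N. norm (real n * a n - 0) < e" by blast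
qed

text \<open>A Krasnoselskii-Mann theorem. Distances to fixed points decrease, and telescoping makes
  the squared residuals summable; as these also decrease, the rate follows. Points of the tail hulls
  are fixed points, so the Fejer argument gives the weak limit.\<close>

theorem averaged_iteration_converges:
  fixes T :: "'a::{real_inner, complete_space} \<Rightarrow> 'a"
  assumes \<kappa>: "\<kappa> > 0"
    and T: "\<And>x y. (norm (T x - T y))\<^sup>2 \<le> (norm (x - y))\<^sup>2 - \<kappa> * (norm ((x - T x) - (y - T y)))\<^sup>2"
    and p: "T p = p" and rec: "\<And>n. x (Suc n) = T (x n)"
  shows "(\<lambda>n. norm (x n - T (x n))) \<in> o(\<lambda>n. 1 / sqrt (real n))"
    and "\<exists>z. T z = z \<and> weakly_converges x z"
    and "\<And>z. T z = z \<Longrightarrow> convergent (\<lambda>n. (norm (x n - z))\<^sup>2)"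
proof -
  have ne: "nonexpansive T"
    unfolding nonexpansive_def
  proof (intro allI)
    fix u v
    have "0 \<le> \<kappa> * (norm ((u - T u) - (v - T v)))\<^sup>2" using \<kappa> by simp
    with T[of u v] have "(norm (T u - T v))\<^sup>2 \<le> (norm (u - v))\<^sup>2" by linarith
    then show "norm (T u - T v) \<le> norm (u - v)" by (rule power2_le_imp_le) simp
  qed
  have step: "\<kappa> * (norm (x n - T (x n)))\<^sup>2 \<le> (norm (x n - z))\<^sup>2 - (norm (x (Suc n) - z))\<^sup>2"
    if "T z = z" for z n
    using T[of "x n" z] that by (simp add: rec)
  show fejer: "convergent (\<lambda>n. (norm (x n - z))\<^sup>2)" if z: "T z = z" for z
  proof -
    have "0 \<le> \<kappa> * (norm (x n - T (x n)))\<^sup>2" for n using \<kappa> by simp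
    then have "decseq (\<lambda>n. (norm (x n - z))\<^sup>2)"
      using step[OF z] by (intro decseq_SucI) (meson diff_ge_0_iff_ge order_trans)
    then obtain L where "(\<lambda>n. (norm (x n - z))\<^sup>2) \<longlonglongrightarrow> L"
      using decseq_convergent[of _ 0] by (metis zero_le_power2)
    then show ?thesis by (auto simp: convergent_def)
  qed
  have "Bseq (\<lambda>n. (norm (x n - p))\<^sup>2)"
    using fejer[OF p] by (rule convergent_imp_Bseq)
  then obtain K where K: "\<And>n. norm ((norm (x n - p))\<^sup>2) \<le> K" by (auto simp: Bseq_def)
  have "norm (x n) \<le> sqrt K + norm p" for n
  proof -
    have "norm (x n - p) \<le> sqrt K" using K[of n] by (intro real_le_rsqrt) simp
    moreover have "norm (x n) \<le> norm (x n - p) + norm p"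
      using norm_triangle_ineq[of "x n - p" p] by simp
    ultimately show ?thesis by linarith
  qed
  then have bd: "bounded (range x)" by (auto simp: bounded_iff)
  obtain L where L: "(\<lambda>n. (norm (x n - p))\<^sup>2) \<longlonglongrightarrow> L"
    using fejer[OF p] by (auto simp: convergent_def)
  have "summable (\<lambda>n. (norm (x n - p))\<^sup>2 - (norm (x (Suc n) - p))\<^sup>2)"
    by (rule telescope_summable'[OF L])
  then have "summable (\<lambda>n. \<kappa> * (norm (x n - T (x n)))\<^sup>2)"
    using step[OF p] \<kappa> by (elim summable_comparison_test') simp
  then have sm: "summable (\<lambda>n. (norm (x n - T (x n)))\<^sup>2)"
    using \<kappa> by (simp add: summable_cmult_iff)
  \<comment> \<open>The next residual is \<open>T (x n) - T (x (Suc n))\<close>, which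
    nonexpansiveness bounds by the current one.\<close>
  have "decseq (\<lambda>n. (norm (x n - T (x n)))\<^sup>2)"
    using ne by (intro decseq_SucI power_mono) (auto simp: nonexpansive_def rec)
  then have lim: "(\<lambda>n. real n * (norm (x n - T (x n)))\<^sup>2) \<longlonglongrightarrow> 0"
    using sm by (intro summable_decseq_times_n_tendsto_0) auto
  show "(\<lambda>n. norm (x n - T (x n))) \<in> o(\<lambda>n. 1 / sqrt (real n))"
  proof (rule smalloI_tendsto)
    have "(\<lambda>n. sqrt (real n * (norm (x n - T (x n)))\<^sup>2)) \<longlonglongrightarrow> sqrt 0"
      by (intro tendsto_real_sqrt lim)
    then show "(\<lambda>n. norm (x n - T (x n)) / (1 / sqrt (real n))) \<longlonglongrightarrow> 0"
      by (simp add: real_sqrt_mult mult.commute)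
    show "\<forall>\<^sub>F n in sequentially. 1 / sqrt (real n) \<noteq> 0"
      using eventually_gt_at_top[of 0] by eventually_elim simp
  qed
  have "(\<lambda>n. sqrt ((norm (x n - T (x n)))\<^sup>2)) \<longlonglongrightarrow> sqrt 0"
    by (intro tendsto_real_sqrt summable_LIMSEQ_zero sm)
  then have "(\<lambda>n. x n - T (x n)) \<longlonglongrightarrow> 0"
    by (simp add: tendsto_norm_zero_iff)
  then have "\<And>z. z \<in> tail_hulls x \<Longrightarrow> T z = z"
    by (rule tail_hulls_subset_Fix[OF ne bd])
  with weak_limit_of_Fejer[OF bd fejer] show "\<exists>z. T z = z \<and> weakly_converges x z"
    by blast
qed

section \<open>The forward-backward Douglas-Rachford operator\<close>

text \<open>The map \<open>N\<close> is forced by the definition. Expanding squares, the hypothesis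
  says that \<open>Id - T\<close> is \<open>1 / (2 * \<theta>)\<close>-cocoercive, which is
  nonexpansiveness of \<open>N\<close>.\<close>

lemma conically_averaged_if_displacement_bound:
  fixes T :: "'a::real_inner \<Rightarrow> 'a"
  assumes \<theta>: "\<theta> > 0"
    and T: "\<And>x y. (norm (T x - T y))\<^sup>2 \<le> (norm (x - y))\<^sup>2 - (1 / \<theta> - 1) * (norm ((x - T x) - (y - T y)))\<^sup>2"
  shows "conically_averaged \<theta> T"
proof -
  define N where "N x = x - (1 / \<theta>) *\<^sub>R (x - T x)" for x
  have "norm (N x - N y) \<le> norm (x - y)" for x y
  proof -
    define X where "X = x - y"
    define D where "D = (x - T x) - (y - T y)"
    have NN: "N x - N y = X - (1 / \<theta>) *\<^sub>R D" and TT: "T x - T y = X - D"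
      by (simp_all add: N_def X_def D_def algebra_simps)
    have "inner X X - 2 * inner X D + inner D D \<le> inner X X - (1 / \<theta> - 1) * inner D D"
      using T[of x y] unfolding TT D_def[symmetric] X_def[symmetric] power2_norm_eq_inner
      by (simp add: inner_simps inner_commute)
    then have "(1 / \<theta>) * inner D D \<le> 2 * inner X D"
      by (simp add: left_diff_distrib)
    then have "(1 / \<theta>) * ((1 / \<theta>) * inner D D) \<le> (1 / \<theta>) * (2 * inner X D)"
      using \<theta> by (intro mult_left_mono) auto
    then have "(norm (N x - N y))\<^sup>2 \<le> (norm X)\<^sup>2"
      unfolding NN power2_norm_eq_inner by (simp add: inner_simps inner_commute)
    then show ?thesis unfolding X_def by (rule power2_le_imp_le) simp
  qed
  then have "nonexpansive N" by (simp add: nonexpansive_def)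
  moreover have "T x = (1 - \<theta>) *\<^sub>R x + \<theta> *\<^sub>R N x" for x
    using \<theta> by (simp add: N_def algebra_simps)
  ultimately show ?thesis using \<theta> by (auto simp: conically_averaged_def)
qed

text \<open>Two negative factors would force \<alpha> and \<beta> both negative, against
  \<open>\<alpha> + \<beta> > 0\<close>.\<close>

lemma one_plus_products_pos:
  fixes \<alpha> \<beta> \<gamma> \<delta> :: real
  assumes "\<alpha> + \<beta> > 0" "\<gamma> > 0" "\<delta> > 0" "(1 + \<gamma> * \<alpha>) * (1 + \<delta> * \<beta>) > 0"
  shows "1 + \<gamma> * \<alpha> > 0" "1 + \<delta> * \<beta> > 0"
proof -
  have "\<not> (1 + \<gamma> * \<alpha> < 0 \<and> 1 + \<delta> * \<beta> < 0)"
  proof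
    assume "1 + \<gamma> * \<alpha> < 0 \<and> 1 + \<delta> * \<beta> < 0"
    then have "\<gamma> * \<alpha> < 0" "\<delta> * \<beta> < 0" by auto
    then have "\<alpha> < 0" "\<beta> < 0" using assms(2,3) by (simp_all add: mult_less_0_iff)
    with assms(1) show False by simp
  qed
  with assms(4) show "1 + \<gamma> * \<alpha> > 0" "1 + \<delta> * \<beta> > 0"
    by (auto simp: zero_less_mult_iff)
qed

text \<open>The two-point inequality with all nonlinear maps abstracted: \<open>X\<close>,
  \<open>p\<close>, \<open>q\<close> and \<open>c\<close> stand for the differences of the
  arguments, of the two resolvents and of the values of \<open>C\<close>. A weighted sum of the
  three monotonicity hypotheses is rewritten as squares.\<close>

lemma splitting_inequality:
  fixes X p q c :: "'a::real_inner" and \<alpha> \<beta> \<gamma> \<delta> \<sigma> \<eta> \<eta>s lam :: real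
  assumes ab: "\<alpha> + \<beta> > 0" and pos: "\<gamma> > 0" "\<delta> > 0" "\<sigma> > 0" "\<eta> > 0"
    and etas_def: "\<eta>s = (4 * \<gamma> * \<delta> * (1 + \<gamma> * \<alpha>) * (1 + \<delta> * \<beta>) - (\<gamma> + \<delta>)\<^sup>2)
                         / (2 * \<gamma> * \<delta>\<^sup>2 * (\<alpha> + \<beta>)) - \<gamma> / (2 * \<sigma>)"
    and lam_def: "lam = 1 + \<delta> / \<gamma>"
    and hp: "inner p (X - p) \<ge> \<gamma> * \<alpha> * (norm p)\<^sup>2"
    and hq: "inner q ((1 - lam) *\<^sub>R X + lam *\<^sub>R p - \<delta> *\<^sub>R c - q) \<ge> \<delta> * \<beta> * (norm q)\<^sup>2"
    and hc: "inner p c \<ge> \<sigma> * (norm c)\<^sup>2"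
  shows "(norm (X - \<eta> *\<^sub>R (p - q)))\<^sup>2 \<le> (norm X)\<^sup>2
        - (\<eta>s / \<eta> - 1) * (norm (\<eta> *\<^sub>R (p - q)))\<^sup>2
        - \<gamma> / (2 * \<eta> * \<sigma>) * (norm (\<eta> *\<^sub>R (p - q) - (2 * \<eta> * \<sigma>) *\<^sub>R c))\<^sup>2
        - \<gamma> * \<eta> / (2 * \<delta>\<^sup>2 * (\<alpha> + \<beta>)) * (norm ((lam - 2 + 2 * \<delta> * \<alpha>) *\<^sub>R p
              + (2 - lam + 2 * \<delta> * \<beta>) *\<^sub>R q))\<^sup>2"
proof -
  define a where "a = lam - 2 + 2 * \<delta> * \<alpha>"
  define b where "b = 2 - lam + 2 * \<delta> * \<beta>"
  define m where "m = \<gamma> / (2 * \<delta>\<^sup>2 * (\<alpha> + \<beta>))"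
  \<comment> \<open>The fraction in \<open>\<eta>s\<close> without the correction for
    \<open>C\<close>; the separated \<open>\<gamma> / (2 * \<sigma>)\<close> later completes the
    square with \<open>c\<close>.\<close>
  define \<kappa> where "\<kappa> = \<eta>s + \<gamma> / (2 * \<sigma>)"
  define den where "den = 2 * \<gamma> * \<delta>\<^sup>2 * (\<alpha> + \<beta>)"
  have den: "den > 0" using ab pos by (simp add: den_def)
  \<comment> \<open>\<open>a'\<close> and \<open>b'\<close> are \<open>a\<close> and
    \<open>b\<close> multiplied by \<gamma>, which makes the coefficient identities polynomial over
    the common denominator \<open>den\<close>.\<close>
  define a' where "a' = \<delta> - \<gamma> + 2 * \<gamma> * \<delta> * \<alpha>"
  define b' where "b' = \<gamma> - \<delta> + 2 * \<gamma> * \<delta> * \<beta>"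
  have a: "a = a' / \<gamma>" and b: "b = b' / \<gamma>"
    using pos by (simp_all add: a_def a'_def b_def b'_def lam_def field_simps)
  have "m * den = \<gamma>\<^sup>2"
    using ab pos by (simp add: m_def den_def power2_eq_square)
  then have m: "m = \<gamma>\<^sup>2 / den" using den by (simp add: field_simps)
  have \<kappa>: "\<kappa> = (4 * \<gamma> * \<delta> * (1 + \<gamma> * \<alpha>) * (1 + \<delta> * \<beta>) - (\<gamma> + \<delta>)\<^sup>2) / den"
    by (simp add: \<kappa>_def etas_def den_def)
  have maa: "m * a\<^sup>2 = a'\<^sup>2 / den" and mbb: "m * b\<^sup>2 = b'\<^sup>2 / den" and mab: "m * a * b = a' * b' / den"
    using pos by (simp_all add: m a b power2_eq_square)
  have coef_p: "\<kappa> + m * a\<^sup>2 = 2 * (1 + \<gamma> * \<alpha>)"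
  proof -
    have "4 * \<gamma> * \<delta> * (1 + \<gamma> * \<alpha>) * (1 + \<delta> * \<beta>) - (\<gamma> + \<delta>)\<^sup>2 + a'\<^sup>2 = 2 * (1 + \<gamma> * \<alpha>) * den"
      unfolding a'_def den_def by algebra
    then show ?thesis using den unfolding \<kappa> maa by (simp add: add_divide_distrib[symmetric])
  qed
  have coef_q: "\<kappa> + m * b\<^sup>2 = 2 * (\<gamma> / \<delta>) * (1 + \<delta> * \<beta>)"
  proof -
    have "4 * \<gamma> * \<delta> * (1 + \<gamma> * \<alpha>) * (1 + \<delta> * \<beta>) - (\<gamma> + \<delta>)\<^sup>2 + b'\<^sup>2
        = 2 * \<gamma> * (1 + \<delta> * \<beta>) * (2 * \<gamma> * \<delta> * (\<alpha> + \<beta>))"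
      unfolding b'_def by algebra
    also have "\<dots> = 2 * (\<gamma> / \<delta>) * (1 + \<delta> * \<beta>) * den"
      using pos by (simp add: den_def power2_eq_square)
    finally show ?thesis using den unfolding \<kappa> mbb by (simp add: add_divide_distrib[symmetric])
  qed
  have coef_pq: "m * a * b - \<kappa> = - (\<gamma> / \<delta> + 1)"
  proof -
    have "a' * b' - (4 * \<gamma> * \<delta> * (1 + \<gamma> * \<alpha>) * (1 + \<delta> * \<beta>) - (\<gamma> + \<delta>)\<^sup>2)
        = - (\<gamma> + \<delta>) * (2 * \<gamma> * \<delta> * (\<alpha> + \<beta>))"
      unfolding a'_def b'_def by algebra
    also have "\<dots> = - (\<gamma> / \<delta> + 1) * den"
      using pos by (simp add: den_def power2_eq_square field_simps)
    finally show ?thesis using den unfolding \<kappa> mab by (simp add: diff_divide_distrib[symmetric])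
  qed
  have quad: "2 * (1 + \<gamma> * \<alpha>) * inner p p + 2 * (\<gamma> / \<delta>) * (1 + \<delta> * \<beta>) * inner q q
      - 2 * (\<gamma> / \<delta> + 1) * inner p q
      = \<kappa> * (norm (p - q))\<^sup>2 + m * (norm (a *\<^sub>R p + b *\<^sub>R q))\<^sup>2"
  proof -
    have "\<kappa> * (norm (p - q))\<^sup>2 + m * (norm (a *\<^sub>R p + b *\<^sub>R q))\<^sup>2
      = (\<kappa> + m * a\<^sup>2) * inner p p + (\<kappa> + m * b\<^sup>2) * inner q q + 2 * (m * a * b - \<kappa>) * inner p q"
      unfolding power2_norm_eq_inner
      by (simp add: inner_simps inner_commute power2_eq_square algebra_simps)
    then show ?thesis unfolding coef_p coef_q coef_pq by (simp add: algebra_simps)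
  qed
  have hp': "2 * (1 + \<gamma> * \<alpha>) * inner p p \<le> 2 * inner X p"
    using hp by (simp add: power2_norm_eq_inner inner_simps inner_commute algebra_simps)
  \<comment> \<open>The weight \<open>2 * (\<gamma> / \<delta>)\<close> normalises the coefficient
    of \<open>inner X q\<close> to -2, so that adding \<open>hp'\<close> produces
    \<open>2 * inner X (p - q)\<close>.\<close>
  have hq': "2 * (\<gamma> / \<delta>) * (1 + \<delta> * \<beta>) * inner q q
      \<le> - 2 * inner X q + 2 * (\<gamma> / \<delta> + 1) * inner p q - 2 * \<gamma> * inner q c"
  proof -
    have "(1 + \<delta> * \<beta>) * inner q q \<le> - (\<delta> / \<gamma>) * inner X q + (1 + \<delta> / \<gamma>) * inner p q - \<delta> * inner q c"
      using hq by (simp add: lam_def power2_norm_eq_inner inner_simps inner_commute algebra_simps)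
    then have "2 * (\<gamma> / \<delta>) * ((1 + \<delta> * \<beta>) * inner q q) \<le>
      2 * (\<gamma> / \<delta>) * (- (\<delta> / \<gamma>) * inner X q + (1 + \<delta> / \<gamma>) * inner p q - \<delta> * inner q c)"
      using pos by (intro mult_left_mono) auto
    also have "\<dots> = - 2 * inner X q + 2 * (\<gamma> / \<delta> + 1) * inner p q - 2 * \<gamma> * inner q c"
      using pos by (simp add: field_simps)
    finally show ?thesis by (simp add: mult.assoc)
  qed
  have hc': "2 * \<gamma> * \<sigma> * inner c c \<le> 2 * \<gamma> * inner p c"
  proof -
    have "2 * \<gamma> * (\<sigma> * inner c c) \<le> 2 * \<gamma> * inner p c"
      using hc pos by (intro mult_left_mono) (auto simp: power2_norm_eq_inner)
    then show ?thesis by (simp add: mult.assoc)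
  qed
  \<comment> \<open>\<open>\<eta> * P\<close> is the total of the three subtracted terms in the
    claim, up to the term \<open>\<eta>\<^sup>2 * (norm (p - q))\<^sup>2\<close> that comes from
    expanding the left-hand side.\<close>
  define P where "P = \<kappa> * (norm (p - q))\<^sup>2 + m * (norm (a *\<^sub>R p + b *\<^sub>R q))\<^sup>2
      - 2 * \<gamma> * inner (p - q) c + 2 * \<gamma> * \<sigma> * inner c c"
  have "P \<le> 2 * inner X (p - q)"
    using hp' hq' hc' quad by (simp add: P_def inner_diff_left inner_diff_right algebra_simps)
  then have "\<eta> * P \<le> \<eta> * (2 * inner X (p - q))"
    using pos by (intro mult_left_mono) auto
  moreover have "(norm (X - \<eta> *\<^sub>R (p - q)))\<^sup>2
      = (norm X)\<^sup>2 - \<eta> * (2 * inner X (p - q)) + \<eta>\<^sup>2 * (norm (p - q))\<^sup>2"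
    unfolding power2_norm_eq_inner by (simp add: inner_simps inner_commute power2_eq_square algebra_simps)
  moreover have "(\<eta>s / \<eta> - 1) * (norm (\<eta> *\<^sub>R (p - q)))\<^sup>2
      = \<eta> * (\<kappa> * (norm (p - q))\<^sup>2) - \<eta> * (\<gamma> / (2 * \<sigma>) * (norm (p - q))\<^sup>2) - \<eta>\<^sup>2 * (norm (p - q))\<^sup>2"
  proof -
    have "(norm (\<eta> *\<^sub>R (p - q)))\<^sup>2 = \<eta>\<^sup>2 * (norm (p - q))\<^sup>2"
      by (simp add: power_mult_distrib del: scaleR_diff_right)
    then show ?thesis
      using pos by (simp add: \<kappa>_def power2_eq_square field_simps del: scaleR_diff_right)
  qed
  moreover have "\<gamma> / (2 * \<eta> * \<sigma>) * (norm (\<eta> *\<^sub>R (p - q) - (2 * \<eta> * \<sigma>) *\<^sub>R c))\<^sup>2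
      = \<eta> * (\<gamma> / (2 * \<sigma>) * (norm (p - q))\<^sup>2 - 2 * \<gamma> * inner (p - q) c + 2 * \<gamma> * \<sigma> * inner c c)"
  proof -
    have eq: "(norm (\<eta> *\<^sub>R (p - q) - (2 * \<eta> * \<sigma>) *\<^sub>R c))\<^sup>2
        = \<eta>\<^sup>2 * ((norm (p - q))\<^sup>2 - 4 * \<sigma> * inner (p - q) c + 4 * \<sigma>\<^sup>2 * inner c c)"
      unfolding power2_norm_eq_inner
      by (simp add: inner_simps inner_commute power2_eq_square algebra_simps)
    show ?thesis unfolding eq using pos by (simp add: power2_eq_square field_simps)
  qed
  moreover have "\<gamma> * \<eta> / (2 * \<delta>\<^sup>2 * (\<alpha> + \<beta>)) * (norm (a *\<^sub>R p + b *\<^sub>R q))\<^sup>2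
      = \<eta> * (m * (norm (a *\<^sub>R p + b *\<^sub>R q))\<^sup>2)"
    by (simp add: m_def)
  ultimately show ?thesis
    unfolding a_def[symmetric] b_def[symmetric] P_def distrib_left right_diff_distrib
    by linarith
qed

theorem theorem4p5:
  fixes A B :: "'a::{real_inner, complete_space} \<Rightarrow> 'a set"
    and C :: "'a \<Rightarrow> 'a"
    and \<alpha> \<beta> \<sigma> \<gamma> \<delta> \<eta> \<eta>s lam :: real
    and JA JB S T :: "'a \<Rightarrow> 'a set"
    and xs :: "nat \<Rightarrow> 'a"
  assumes mA: "max_alpha_monotone \<alpha> A"
    and mB: "max_alpha_monotone \<beta> B"
    and ab: "\<alpha> + \<beta> > 0"
    and cC: "cocoercive \<sigma> C"
    and gpos: "\<gamma> > 0" and dpos: "\<delta> > 0"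
    and etas_def: "\<eta>s = (4 * \<gamma> * \<delta> * (1 + \<gamma> * \<alpha>) * (1 + \<delta> * \<beta>) - (\<gamma> + \<delta>)\<^sup>2)
                         / (2 * \<gamma> * \<delta>\<^sup>2 * (\<alpha> + \<beta>)) - \<gamma> / (2 * \<sigma>)"
    and etas_pos: "\<eta>s > 0"
    and lam_def: "lam = 1 + \<delta> / \<gamma>"
    and epos: "\<eta> > 0"
    and JA_def: "JA = resolvent (op_scale \<gamma> A)"
    and JB_def: "JB = resolvent (op_scale \<delta> B)"
    and S_def: "S = op_sum (op_sum (op_fun (\<lambda>x. (1 - lam) *\<^sub>R x)) (op_scale lam JA))
                           (op_scale (- \<delta>) (op_comp (op_fun C) JA))"
    and T_def: "T = op_sum (op_sum (op_fun id) (op_scale (- \<eta>) JA)) (op_scale \<eta> (op_comp JB S))"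
    and xs_rec: "\<And>n. xs (Suc n) = sv T (xs n)"
  shows
    "((\<forall>x. T x \<noteq> {}) \<and> (\<forall>x y z. y \<in> T x \<longrightarrow> z \<in> T x \<longrightarrow> y = z))
   \<and> (\<forall>x y. (norm (sv T x - sv T y))\<^sup>2 \<le> (norm (x - y))\<^sup>2
        - (\<eta>s / \<eta> - 1) * (norm ((x - sv T x) - (y - sv T y)))\<^sup>2
        - \<gamma> / (2 * \<eta> * \<sigma>) * (norm ((x - sv T x) - (y - sv T y)
              - (2 * \<eta> * \<sigma>) *\<^sub>R (C (sv JA x) - C (sv JA y))))\<^sup>2
        - \<gamma> * \<eta> / (2 * \<delta>\<^sup>2 * (\<alpha> + \<beta>)) * (norm ((lam - 2 + 2 * \<delta> * \<alpha>) *\<^sub>R (sv JA x - sv JA y)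
              + (2 - lam + 2 * \<delta> * \<beta>) *\<^sub>R (sv (op_comp JB S) x - sv (op_comp JB S) y)))\<^sup>2)
   \<and> conically_averaged (\<eta> / \<eta>s) (sv T)
   \<and> (zer (op_sum (op_sum A B) (op_fun C)) \<noteq> {} \<and> \<eta> < \<eta>s \<longrightarrow>
       (\<lambda>n. norm (xs n - sv T (xs n))) \<in> o(\<lambda>n. 1 / sqrt (real n)) \<and>
       (\<exists>xstar. sv T xstar = xstar \<and> weakly_converges xs xstar \<and>
          (\<lambda>n. sv JA (xs n)) \<longlonglongrightarrow> sv JA xstar \<and>
          (\<lambda>n. sv (op_comp JB S) (xs n)) \<longlonglongrightarrow> sv (op_comp JB S) xstar \<and>
          sv JA xstar = sv (op_comp JB S) xstar \<and>
          sv JA xstar \<in> zer (op_sum (op_sum A B) (op_fun C)) \<and>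
          (\<lambda>n. C (sv JA (xs n))) \<longlonglongrightarrow> C (sv JA xstar) \<and>
          zer (op_sum (op_sum A B) (op_fun C)) = {sv JA xstar}))"
proof -

  \<comment> \<open>Single-valuedness of the resolvents and of \<open>T\<close>\<close>
  have \<sigma>: "\<sigma> > 0" using cC by (simp add: cocoercive_def)
  have amA: "alpha_monotone \<alpha> A" and amB: "alpha_monotone \<beta> B"
    using mA mB by (simp_all add: max_alpha_monotone_def)
  have pos: "1 + \<gamma> * \<alpha> > 0" "1 + \<delta> * \<beta> > 0"
  proof -
    have den: "0 < 2 * \<gamma> * \<delta>\<^sup>2 * (\<alpha> + \<beta>)" using gpos dpos ab by simp
    have "0 < \<gamma> / (2 * \<sigma>)" using gpos \<sigma> by simp
    with etas_pos have "0 < (4 * \<gamma> * \<delta> * (1 + \<gamma> * \<alpha>) * (1 + \<delta> * \<beta>) - (\<gamma> + \<delta>)\<^sup>2)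
        / (2 * \<gamma> * \<delta>\<^sup>2 * (\<alpha> + \<beta>))"
      unfolding etas_def by linarith
    \<comment> \<open>Positivity of \<open>\<eta>s\<close> forces a positive numerator, hence a
      positive product of the two factors.\<close>
    then have "(\<gamma> + \<delta>)\<^sup>2 < 4 * \<gamma> * \<delta> * (1 + \<gamma> * \<alpha>) * (1 + \<delta> * \<beta>)"
      using den by (simp only: zero_less_divide_iff) linarith
    then have "0 < (4 * \<gamma> * \<delta>) * ((1 + \<gamma> * \<alpha>) * (1 + \<delta> * \<beta>))"
      by (metis mult.assoc order_le_less_trans zero_le_power2)
    then have "0 < (1 + \<gamma> * \<alpha>) * (1 + \<delta> * \<beta>)"
      by (rule zero_less_mult_pos) (use gpos dpos in simp)
    then show "1 + \<gamma> * \<alpha> > 0" "1 + \<delta> * \<beta> > 0"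
      using one_plus_products_pos[OF ab gpos dpos] by simp_all
  qed
  obtain ja where ja: "\<And>x. JA x = {ja x}"
    using resolvent_singleton[OF mA gpos pos(1)] unfolding JA_def by metis
  obtain jb where jb: "\<And>x. JB x = {jb x}"
    using resolvent_singleton[OF mB dpos pos(2)] unfolding JB_def by metis
  define s where "s x = (1 - lam) *\<^sub>R x + lam *\<^sub>R ja x - \<delta> *\<^sub>R C (ja x)" for x
  define b where "b x = jb (s x)" for x
  define t where "t x = x - \<eta> *\<^sub>R (ja x - b x)" for x
  have S: "S x = {s x}" for x
    by (auto simp: S_def s_def op_sum_def op_fun_def op_scale_def op_comp_def ja)
  have BS: "op_comp JB S x = {b x}" for x
    by (simp add: op_comp_def S jb b_def)
  have T: "T x = {t x}" for x
    by (auto simp: T_def t_def op_sum_def op_fun_def op_scale_def BS ja scaleR_diff_right)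
  have sv: "sv JA x = ja x" "sv (op_comp JB S) x = b x" "sv T x = t x" for x
    by (simp_all add: sv_def ja BS T)

  have a_iff: "a = ja x \<longleftrightarrow> (\<exists>u\<in>A a. x = a + \<gamma> *\<^sub>R u)" for a x
    using mem_resolvent_iff[of a \<gamma> A x] ja[of x] by (simp add: JA_def)
  have b_iff: "a = jb x \<longleftrightarrow> (\<exists>u\<in>B a. x = a + \<delta> *\<^sub>R u)" for a x
    using mem_resolvent_iff[of a \<delta> B x] jb[of x] by (simp add: JB_def)

  \<comment> \<open>The inequality for \<open>T\<close>\<close>
  define gap where "gap x y = \<gamma> / (2 * \<eta> * \<sigma>) * (norm ((x - t x) - (y - t y)
              - (2 * \<eta> * \<sigma>) *\<^sub>R (C (ja x) - C (ja y))))\<^sup>2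
        + \<gamma> * \<eta> / (2 * \<delta>\<^sup>2 * (\<alpha> + \<beta>)) * (norm ((lam - 2 + 2 * \<delta> * \<alpha>) *\<^sub>R (ja x - ja y)
              + (2 - lam + 2 * \<delta> * \<beta>) *\<^sub>R (b x - b y)))\<^sup>2" for x y
  \<comment> \<open>\<open>gap\<close> collects the two squares that are dropped for averagedness
    but drive the strong convergence.\<close>
  have gap_nonneg: "0 \<le> gap x y" for x y
    unfolding gap_def using gpos \<sigma> epos ab by simp
  have ineq: "(norm (t x - t y))\<^sup>2 \<le> (norm (x - y))\<^sup>2
        - (\<eta>s / \<eta> - 1) * (norm ((x - t x) - (y - t y)))\<^sup>2 - gap x y" for x y
  proof -
    define p where "p = ja x - ja y"
    define q where "q = b x - b y"
    have d: "(x - t x) - (y - t y) = \<eta> *\<^sub>R (p - q)" and tt: "t x - t y = (x - y) - \<eta> *\<^sub>R (p - q)"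
      by (simp_all add: t_def p_def q_def algebra_simps)
    have "inner p ((x - y) - p) \<ge> \<gamma> * \<alpha> * (norm p)\<^sup>2"
      unfolding p_def using ja by (intro resolvent_mono[OF amA gpos]) (auto simp: JA_def)
    moreover have "inner q (s x - s y - q) \<ge> \<delta> * \<beta> * (norm q)\<^sup>2"
      unfolding q_def b_def using jb by (intro resolvent_mono[OF amB dpos]) (auto simp: JB_def)
    moreover have "s x - s y = (1 - lam) *\<^sub>R (x - y) + lam *\<^sub>R p - \<delta> *\<^sub>R (C (ja x) - C (ja y))"
      by (simp add: s_def p_def algebra_simps)
    moreover have "inner p (C (ja x) - C (ja y)) \<ge> \<sigma> * (norm (C (ja x) - C (ja y)))\<^sup>2"
      using cC by (simp add: cocoercive_def p_def)
    ultimately show ?thesis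
      using splitting_inequality[OF ab gpos dpos \<sigma> epos etas_def lam_def, of p "x - y" q "C (ja x) - C (ja y)"]
      unfolding gap_def d tt p_def[symmetric] q_def[symmetric] by simp
  qed
  have ineq': "(norm (t x - t y))\<^sup>2 \<le> (norm (x - y))\<^sup>2
        - (\<eta>s / \<eta> - 1) * (norm ((x - t x) - (y - t y)))\<^sup>2" for x y
    using ineq[of x y] gap_nonneg[of x y] by linarith

  \<comment> \<open>Correspondence between zeros and fixed points\<close>
  let ?Z = "zer (op_sum (op_sum A B) (op_fun C))"
  have mem_Z: "z \<in> ?Z \<longleftrightarrow> (\<exists>u v. u \<in> A z \<and> v \<in> B z \<and> u + v + C z = 0)" for z
    by (fastforce simp: zer_def op_sum_def op_fun_def)
  have Fix_iff: "t x = x \<longleftrightarrow> b x = ja x" for x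
    using epos by (auto simp: t_def)
  \<comment> \<open>The choice of \<open>lam\<close> gives
    \<open>(1 - lam) * \<gamma> = - \<delta>\<close>. Hence \<open>z\<close> is the second resolvent
    of this point exactly when \<open>- (u + C z)\<close> belongs to \<open>B z\<close>.\<close>
  have s_eq: "s (z + \<gamma> *\<^sub>R u) = z - \<delta> *\<^sub>R (u + C z)" if "ja (z + \<gamma> *\<^sub>R u) = z" for z u
    using gpos by (simp add: s_def that lam_def algebra_simps)
  have Fix_to_Z: "ja x \<in> ?Z" if fx: "t x = x" for x
  proof -
    obtain u where u: "u \<in> A (ja x)" "x = ja x + \<gamma> *\<^sub>R u"
      using a_iff by blast
    obtain v where v: "v \<in> B (ja x)" "s x = ja x + \<delta> *\<^sub>R v"
      using b_iff[of "ja x" "s x"] Fix_iff[of x] fx unfolding b_def by metis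
    have "s x = ja x - \<delta> *\<^sub>R (u + C (ja x))"
      using s_eq[of "ja x" u] u(2) by simp
    with v(2) have "\<delta> *\<^sub>R (u + v + C (ja x)) = 0"
      by (simp add: algebra_simps)
    with u(1) v(1) dpos show ?thesis by (auto simp: mem_Z)
  qed
  have Z_to_Fix: "\<exists>x. t x = x \<and> ja x = z" if zZ: "z \<in> ?Z" for z
  proof -
    obtain u v where uv: "u \<in> A z" "v \<in> B z" "u + v + C z = 0"
      using zZ unfolding mem_Z by blast
    have jz: "ja (z + \<gamma> *\<^sub>R u) = z" using a_iff uv(1) by metis
    have "u + C z = - v"
      using uv(3) by (simp add: eq_neg_iff_add_eq_0 algebra_simps)
    then have "s (z + \<gamma> *\<^sub>R u) = z + \<delta> *\<^sub>R v"
      by (simp add: s_eq[OF jz])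
    then have "b (z + \<gamma> *\<^sub>R u) = z" using b_iff uv(2) unfolding b_def by metis
    with jz show ?thesis unfolding Fix_iff by metis
  qed

  \<comment> \<open>Convergence of the iteration and uniqueness of the zero\<close>
  have conv: "(\<lambda>n. norm (xs n - t (xs n))) \<in> o(\<lambda>n. 1 / sqrt (real n)) \<and>
       (\<exists>xstar. t xstar = xstar \<and> weakly_converges xs xstar \<and>
          (\<lambda>n. ja (xs n)) \<longlonglongrightarrow> ja xstar \<and> (\<lambda>n. b (xs n)) \<longlonglongrightarrow> b xstar \<and>
          ja xstar = b xstar \<and> ja xstar \<in> ?Z \<and>
          (\<lambda>n. C (ja (xs n))) \<longlonglongrightarrow> C (ja xstar) \<and> ?Z = {ja xstar})"
    if ne: "?Z \<noteq> {}" and lt: "\<eta> < \<eta>s"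
  proof -
    have \<kappa>: "\<eta>s / \<eta> - 1 > 0" using lt epos by simp
    have rec: "xs (Suc n) = t (xs n)" for n using xs_rec by (simp add: sv)
    obtain p where p: "t p = p" using ne Z_to_Fix by blast
    note KM = averaged_iteration_converges[where T = t and x = xs, OF \<kappa> ineq' p rec]
    have res: "(\<lambda>n. xs n - t (xs n)) \<longlonglongrightarrow> 0"
    proof -
      have "(\<lambda>n. 1 / sqrt (real n)) \<longlonglongrightarrow> 0"
        by (rule real_tendsto_divide_at_top[OF tendsto_const
            filterlim_compose[OF sqrt_at_top filterlim_real_sequentially]])
      moreover have "\<forall>\<^sub>F n in sequentially. norm (xs n - t (xs n)) \<le> 1 / sqrt (real n)"
        using landau_o.smallD[OF KM(1), of 1] by simp
      ultimately show ?thesis by (rule Lim_null_comparison[rotated])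
    qed
    \<comment> \<open>Shown for every fixed point, not only the weak limit: uniqueness of limits
      then makes \<open>ja\<close> constant on the fixed points.\<close>
    have strong: "(\<lambda>n. ja (xs n)) \<longlonglongrightarrow> ja z \<and> (\<lambda>n. b (xs n)) \<longlonglongrightarrow> b z
        \<and> (\<lambda>n. C (ja (xs n))) \<longlonglongrightarrow> C (ja z)" if z: "t z = z" for z
    proof -
      obtain L where L: "(\<lambda>n. (norm (xs n - z))\<^sup>2) \<longlonglongrightarrow> L"
        using KM(3)[OF z] by (auto simp: convergent_def)
      \<comment> \<open>The gap is squeezed by the decrease of the squared distance to
        \<open>z\<close>, which vanishes because these distances converge.\<close>
      have gap0: "(\<lambda>n. gap (xs n) z) \<longlonglongrightarrow> 0"
      proof (rule tendsto_sandwich[OF _ _ tendsto_const])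
        show "(\<lambda>n. (norm (xs n - z))\<^sup>2 - (norm (xs (Suc n) - z))\<^sup>2) \<longlonglongrightarrow> 0"
          using tendsto_diff[OF L LIMSEQ_Suc[OF L]] by simp
        have "gap (xs n) z \<le> (norm (xs n - z))\<^sup>2 - (norm (xs (Suc n) - z))\<^sup>2" for n
        proof -
          have "0 \<le> (\<eta>s / \<eta> - 1) * (norm ((xs n - t (xs n)) - (z - t z)))\<^sup>2"
            using \<kappa> by simp
          with ineq[of "xs n" z] z rec[of n] show ?thesis by simp
        qed
        then show "\<forall>\<^sub>F n in sequentially. gap (xs n) z \<le> (norm (xs n - z))\<^sup>2 - (norm (xs (Suc n) - z))\<^sup>2"
          by simp
      qed (use gap_nonneg in auto)
      have vanish: "f \<longlonglongrightarrow> 0"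
        if "k > 0" "\<And>n. k * (norm (f n))\<^sup>2 \<le> gap (xs n) z" for k :: real and f :: "nat \<Rightarrow> 'a"
      proof -
        have "(\<lambda>n. k * (norm (f n))\<^sup>2) \<longlonglongrightarrow> 0"
          using that by (intro tendsto_sandwich[OF _ _ tendsto_const gap0]) auto
        from tendsto_mult_right_zero[OF this, of "1 / k"] have "(\<lambda>n. (norm (f n))\<^sup>2) \<longlonglongrightarrow> 0"
          using that(1) by simp
        from tendsto_real_sqrt[OF this] show ?thesis
          by (simp add: tendsto_norm_zero_iff)
      qed
      have k: "\<gamma> / (2 * \<eta> * \<sigma>) > 0" "\<gamma> * \<eta> / (2 * \<delta>\<^sup>2 * (\<alpha> + \<beta>)) > 0"
        using gpos epos \<sigma> dpos ab by simp_all
      have 1: "(\<lambda>n. xs n - t (xs n) - (z - t z)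
          - (2 * \<eta> * \<sigma>) *\<^sub>R (C (ja (xs n)) - C (ja z))) \<longlonglongrightarrow> 0"
        using gpos epos \<sigma> ab by (intro vanish[OF k(1)]) (simp add: gap_def)
      have 2: "(\<lambda>n. (lam - 2 + 2 * \<delta> * \<alpha>) *\<^sub>R (ja (xs n) - ja z)
          + (2 - lam + 2 * \<delta> * \<beta>) *\<^sub>R (b (xs n) - b z)) \<longlonglongrightarrow> 0"
        using gpos epos \<sigma> ab by (intro vanish[OF k(2)]) (simp add: gap_def)
      have bz: "b z = ja z" using z by (simp add: Fix_iff)
      \<comment> \<open>Subtracting the first vanishing square's argument from the residual isolates
        the difference of the values of \<open>C\<close>.\<close>
      have "(\<lambda>n. (1 / (2 * \<eta> * \<sigma>)) *\<^sub>R ((xs n - t (xs n)) - (xs n - t (xs n) - (z - t z)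
          - (2 * \<eta> * \<sigma>) *\<^sub>R (C (ja (xs n)) - C (ja z))))) \<longlonglongrightarrow> (1 / (2 * \<eta> * \<sigma>)) *\<^sub>R (0 - 0)"
        by (intro tendsto_intros res 1)
      then have "(\<lambda>n. C (ja (xs n)) - C (ja z)) \<longlonglongrightarrow> 0"
        using z epos \<sigma> by simp
      then have C_lim: "(\<lambda>n. C (ja (xs n))) \<longlonglongrightarrow> C (ja z)"
        by (rule LIM_zero_cancel)
      have "(\<lambda>n. (1 / \<eta>) *\<^sub>R (xs n - t (xs n))) \<longlonglongrightarrow> (1 / \<eta>) *\<^sub>R 0"
        by (intro tendsto_intros res)
      then have ab_lim: "(\<lambda>n. ja (xs n) - b (xs n)) \<longlonglongrightarrow> 0"
        using epos by (simp add: t_def)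
      \<comment> \<open>Adding a multiple of \<open>ja (xs n) - b (xs n)\<close> replaces
        \<open>b\<close> by \<open>ja\<close>. The two coefficients sum to
        \<open>2 * \<delta> * (\<alpha> + \<beta>)\<close>, which is positive and can be divided
        out.\<close>
      have "(\<lambda>n. (1 / (2 * \<delta> * (\<alpha> + \<beta>))) *\<^sub>R (((lam - 2 + 2 * \<delta> * \<alpha>) *\<^sub>R (ja (xs n) - ja z)
          + (2 - lam + 2 * \<delta> * \<beta>) *\<^sub>R (b (xs n) - b z))
          + (2 - lam + 2 * \<delta> * \<beta>) *\<^sub>R (ja (xs n) - b (xs n))))
        \<longlonglongrightarrow> (1 / (2 * \<delta> * (\<alpha> + \<beta>))) *\<^sub>R (0 + (2 - lam + 2 * \<delta> * \<beta>) *\<^sub>R 0)"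
        by (intro tendsto_intros 2 ab_lim)
      moreover have "((lam - 2 + 2 * \<delta> * \<alpha>) *\<^sub>R (ja (xs n) - ja z)
          + (2 - lam + 2 * \<delta> * \<beta>) *\<^sub>R (b (xs n) - b z))
          + (2 - lam + 2 * \<delta> * \<beta>) *\<^sub>R (ja (xs n) - b (xs n))
        = (2 * \<delta> * (\<alpha> + \<beta>)) *\<^sub>R (ja (xs n) - ja z)" for n
        unfolding bz by (simp add: algebra_simps)
      ultimately have "(\<lambda>n. ja (xs n) - ja z) \<longlonglongrightarrow> 0"
        using dpos ab by simp
      then have a_lim: "(\<lambda>n. ja (xs n)) \<longlonglongrightarrow> ja z"
        by (rule LIM_zero_cancel)
      have "(\<lambda>n. b (xs n)) \<longlonglongrightarrow> b z"
        using tendsto_diff[OF a_lim ab_lim] bz by simp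
      with a_lim C_lim show ?thesis by blast
    qed
    obtain z where z: "t z = z" "weakly_converges xs z"
      using KM(2) by blast
    \<comment> \<open>Each zero is \<open>ja\<close> of some fixed point, and by
      \<open>strong\<close> it is the limit of the same sequence \<open>ja (xs n)\<close>.\<close>
    have "?Z = {ja z}"
      using Fix_to_Z[OF z(1)] Z_to_Fix strong z(1) by (blast intro: LIMSEQ_unique)
    then show ?thesis
      using KM(1) z strong[OF z(1)] Fix_iff[of z] by auto
  qed

  have avg: "conically_averaged (\<eta> / \<eta>s) t"
    using ineq' epos etas_pos by (intro conically_averaged_if_displacement_bound) auto
  show ?thesis
    unfolding sv
  proof (intro conjI allI)
    show "T x \<noteq> {}" for x by (simp add: T)
    show "y \<in> T x \<longrightarrow> z \<in> T x \<longrightarrow> y = z" for x y z by (simp add: T)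
    show "conically_averaged (\<eta> / \<eta>s) t" by (rule avg)
    show "?Z \<noteq> {} \<and> \<eta> < \<eta>s \<longrightarrow> (\<lambda>n. norm (xs n - t (xs n))) \<in> o(\<lambda>n. 1 / sqrt (real n)) \<and>
       (\<exists>xstar. t xstar = xstar \<and> weakly_converges xs xstar \<and>
          (\<lambda>n. ja (xs n)) \<longlonglongrightarrow> ja xstar \<and> (\<lambda>n. b (xs n)) \<longlonglongrightarrow> b xstar \<and>
          ja xstar = b xstar \<and> ja xstar \<in> ?Z \<and>
          (\<lambda>n. C (ja (xs n))) \<longlonglongrightarrow> C (ja xstar) \<and> ?Z = {ja xstar})"
      using conv by blast
  qed (use ineq in \<open>simp add: gap_def algebra_simps\<close>)
qed

end
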